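(* Let $\Omega$ be a base space of locally integrable matrix functions with its linear skew-product flow $\Psi$ as in the context, and let $\omega\in\Omega$. Suppose that the equation $\dot x=A(\omega_t)x$ has (uniform) $\mu$-growth for some slow growth rate $\mu$ (equivalently, neither $+\infty$ nor $-\infty$ belongs to $\Sigma_{\mu\mathrm{D}}(\omega)$). Then for every $\widehat\omega\in\mathbb{A}(\omega)\cup\mathbb{O}(\omega)$ the equation $\dot x=A(\widehat\omega_t)x$ does not have a dichotomy, i.e. it does not have nonuniform $\sigma$-dichotomy for any growth rate $\sigma$.
   Context: Skew-product setting. $N\ge1$ and $\Omega$ is a space of locally integrable functions $\omega:\mathbb{R}\to\mathbb{R}^{N\times N}$, endowed with a topology such that the translation flow $\mathbb{R}\times\Omega\to\Omega$, $(\tau,\omega)\mapsto\omega_\tau$, $\omega_\tau(t)=\omega(t+\tau)$, is well defined and continuous; the evaluation map $A:\Omega\to\mathbb{R}^{N\times N}$, $A(\omega)=\omega(0)$, is continuous (so $A(\omega_t)=\omega(t)$); if $\widehat\omega=\lim_n\omega_{\tau_n}$ in $\Omega$ with $\tau_n\searrow-\infty$ or $\tau_n\nearrow+\infty$, then $\widehat\omega(t)=\lim_n\omega_{\tau_n}(t)$ for almost every $t$; and $(\omega,t,s)\mapsto\Phi_\omega(t,s)$ is jointly continuous, where $\Phi_\omega(t,s)$ denotes the evolution operator of $\dot x=A(\omega_t)x$. The linear skew-product flow is $\Psi(t,\omega,x)=(\omega_t,\Phi_\omega(t,0)x)$ on $\Omega\times\mathbb{R}^N$. The alpha limit set $\mathbb{A}(\omega)$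 (resp. omega limit set $\mathbb{O}(\omega)$) is the set of $\widehat\omega\in\Omega$ for which there is a sequence $\tau_n\searrow-\infty$ (resp. $\tau_n\nearrow+\infty$) with $\widehat\omega=\lim_{n\to\infty}\omega_{\tau_n}$ in $\Omega$. Growth rates. A growth rate is a strictly increasing differentiable function $\mu:\mathbb{R}\to\mathbb{R}^+$ with $\mu(0)=1$, $\lim_{t\to+\infty}\mu(t)=+\infty$, $\lim_{t\to-\infty}\mu(t)=0$. For $r\in(0,1)$ let $\mathrm{u}_r(t)=e^{\mathrm{sgn}(t)((|t|+1)^r-1)}$. The growth rate $\mu$ is slow if there are $r\in(0,1)$ and $M\ge1$ with $\frac{\mu(t)}{\mu(s)}\le M\frac{\mathrm{u}_r(t)}{\mathrm{u}_r(s)}$ for all $t\ge s$. Growth and dichotomy. Let $\dot x=B(t)x$ ($B$ locally integrable) have evolution operator $\Phi$. It has (uniform) $\mu$-growth if there are $L\ge1$, $a>0$ with $\|\Phi(t,s)\|\le L(\mu(t)/\mu(s))^{\mathrm{sgn}(t-s)a}$ for all $t,s\in\mathbb{R}$. It has nonuniform $\sigma$-dichotomy if there are projections $\mathrm{P}(s)$ with $\mathrm{P}(t)\Phi(t,s)=\Phi(t,s)\mathrm{P}(s)$ for all $t,s\in\mathbb{R}$, and constants $K\ge1$, $\alpha<0$, $\beta>0$, $\theta,\nu\ge0$ with $\alpha+\theta<0$, $\beta-\nu>0$ such that $\|\Phi(t,s)\mathrm{P}(s)\|\le K(\sigma(t)/\sigma(s))^\alpha\sigma(s)^{\mathrm{sgn}(s)\theta}$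 for $t\ge s$ and $\|\Phi(t,s)[\mathrm{Id}-\mathrm{P}(s)]\|\le K(\sigma(t)/\sigma(s))^\beta\sigma(s)^{\mathrm{sgn}(s)\nu}$ for $t\le s$; it has uniform $\sigma$-dichotomy if moreover $\theta=\nu=0$. Spectrum at $\pm\infty$: $+\infty\notin\Sigma_{\mu\mathrm{D}}(\omega)$ (resp. $-\infty\notin\Sigma_{\mu\mathrm{D}}(\omega)$) means that there is $\widehat\gamma\in\mathbb{R}$ such that $\dot y=\big(\omega(t)-\widehat\gamma\frac{\dot\mu(t)}{\mu(t)}\mathrm{Id}\big)y$ has uniform $\mu$-dichotomy with projector $\mathrm{P}\equiv\mathrm{Id}$ (resp. $\mathrm{P}\equiv0$). *)

theory Defs
  imports "HOL-Analysis.Analysis"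
begin

section \<open>Linear equations and their evolution operators\<close>

definition locally_integrable :: "(real \<Rightarrow> real^'n^'n) \<Rightarrow> bool" where
  "locally_integrable B \<longleftrightarrow> (\<forall>a b. B absolutely_integrable_on {a..b})"

text \<open>The Caratheodory form of \<open>d/dt \<Phi>(t,s) = B(t) \<Phi>(t,s)\<close>, \<open>\<Phi>(s,s) = Id\<close>:
  \<open>\<Phi>(t,s) = Id + \<integral>\<^sub>s\<^sup>t B(u) \<Phi>(u,s) du\<close>, where the two conjuncts are the cases
  \<open>s \<le> t\<close> and \<open>t \<le> s\<close>. An indefinite integral is continuous, so \<open>\<Phi>(\<cdot>,s)\<close> is
  continuous, and for locally integrable \<open>B\<close> the integral is an ordinary Lebesgue
  integral and \<open>\<Phi>\<close> exists and is unique.\<close>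

definition is_evolution_operator ::
    "(real \<Rightarrow> real^'n^'n) \<Rightarrow> (real \<Rightarrow> real \<Rightarrow> real^'n^'n) \<Rightarrow> bool" where
  "is_evolution_operator B \<Phi> \<longleftrightarrow>
     (\<forall>s t. (s \<le> t \<longrightarrow> ((\<lambda>u. B u ** \<Phi> u s) has_integral (\<Phi> t s - mat 1)) {s..t}) \<and>
            (t \<le> s \<longrightarrow> ((\<lambda>u. B u ** \<Phi> u s) has_integral (mat 1 - \<Phi> t s)) {t..s}))"

definition evolution_operator :: "(real \<Rightarrow> real^'n^'n) \<Rightarrow> real \<Rightarrow> real \<Rightarrow> real^'n^'n" where
  "evolution_operator B = (THE \<Phi>. is_evolution_operator B \<Phi>)"

text \<open>The library norm on \<open>real^'n^'n\<close> is the Frobenius norm; this is the operator norm.\<close>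

definition mnorm :: "real^'n^'n \<Rightarrow> real" where
  "mnorm M = onorm (\<lambda>x. M *v x)"

section \<open>Growth rates\<close>

definition growth_rate :: "(real \<Rightarrow> real) \<Rightarrow> bool" where
  "growth_rate \<mu> \<longleftrightarrow>
     strict_mono \<mu> \<and> (\<forall>t. \<mu> differentiable (at t)) \<and> (\<forall>t. 0 < \<mu> t) \<and> \<mu> 0 = 1 \<and>
     filterlim \<mu> at_top at_top \<and> (\<mu> \<longlongrightarrow> 0) at_bot"

definition u_rate :: "real \<Rightarrow> real \<Rightarrow> real" where
  "u_rate r t = exp (sgn t * ((\<bar>t\<bar> + 1) powr r - 1))"

definition slow :: "(real \<Rightarrow> real) \<Rightarrow> bool" where
  "slow \<mu> \<longleftrightarrow>
     (\<exists>r M. 0 < r \<and> r < 1 \<and> M \<ge> 1 \<and>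
        (\<forall>t s. t \<ge> s \<longrightarrow> \<mu> t / \<mu> s \<le> M * (u_rate r t / u_rate r s)))"

section \<open>Growth, dichotomy, and the spectrum at infinity\<close>

definition has_growth :: "(real \<Rightarrow> real) \<Rightarrow> (real \<Rightarrow> real^'n^'n) \<Rightarrow> bool" where
  "has_growth \<mu> B \<longleftrightarrow>
     (\<exists>L a. L \<ge> 1 \<and> a > 0 \<and>
        (\<forall>t s. mnorm (evolution_operator B t s) \<le> L * (\<mu> t / \<mu> s) powr (sgn (t - s) * a)))"

definition dichotomy_with ::
    "(real \<Rightarrow> real) \<Rightarrow> (real \<Rightarrow> real^'n^'n) \<Rightarrow> (real \<Rightarrow> real^'n^'n) \<Rightarrow> real \<Rightarrow> real \<Rightarrow> bool" where
  "dichotomy_with \<sigma> B P \<theta> \<nu> \<longleftrightarrow>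
     (\<forall>s. P s ** P s = P s) \<and>
     (\<forall>t s. P t ** evolution_operator B t s = evolution_operator B t s ** P s) \<and>
     \<theta> \<ge> 0 \<and> \<nu> \<ge> 0 \<and>
     (\<exists>K \<alpha> \<beta>. K \<ge> 1 \<and> \<alpha> < 0 \<and> \<beta> > 0 \<and> \<alpha> + \<theta> < 0 \<and> \<beta> - \<nu> > 0 \<and>
        (\<forall>t s. t \<ge> s \<longrightarrow>
           mnorm (evolution_operator B t s ** P s)
             \<le> K * (\<sigma> t / \<sigma> s) powr \<alpha> * \<sigma> s powr (sgn s * \<theta>)) \<and>
        (\<forall>t s. t \<le> s \<longrightarrow>
           mnorm (evolution_operator B t s ** (mat 1 - P s))
             \<le> K * (\<sigma> t / \<sigma> s) powr \<beta> * \<sigma> s powr (sgn s * \<nu>)))"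

definition nonuniform_dichotomy :: "(real \<Rightarrow> real) \<Rightarrow> (real \<Rightarrow> real^'n^'n) \<Rightarrow> bool" where
  "nonuniform_dichotomy \<sigma> B \<longleftrightarrow> (\<exists>P \<theta> \<nu>. dichotomy_with \<sigma> B P \<theta> \<nu>)"

definition uniform_dichotomy_with ::
    "(real \<Rightarrow> real) \<Rightarrow> (real \<Rightarrow> real^'n^'n) \<Rightarrow> (real \<Rightarrow> real^'n^'n) \<Rightarrow> bool" where
  "uniform_dichotomy_with \<sigma> B P \<longleftrightarrow> dichotomy_with \<sigma> B P 0 0"

definition shifted :: "(real \<Rightarrow> real) \<Rightarrow> real \<Rightarrow> (real \<Rightarrow> real^'n^'n) \<Rightarrow> real \<Rightarrow> real^'n^'n" where
  "shifted \<mu> \<gamma> B = (\<lambda>t. B t - (\<gamma> * (deriv \<mu> t / \<mu> t)) *\<^sub>R mat 1)"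

definition pinfty_notin_spectrum :: "(real \<Rightarrow> real) \<Rightarrow> (real \<Rightarrow> real^'n^'n) \<Rightarrow> bool" where
  "pinfty_notin_spectrum \<mu> B \<longleftrightarrow>
     (\<exists>\<gamma>. uniform_dichotomy_with \<mu> (shifted \<mu> \<gamma> B) (\<lambda>_. mat 1))"

definition minfty_notin_spectrum :: "(real \<Rightarrow> real) \<Rightarrow> (real \<Rightarrow> real^'n^'n) \<Rightarrow> bool" where
  "minfty_notin_spectrum \<mu> B \<longleftrightarrow>
     (\<exists>\<gamma>. uniform_dichotomy_with \<mu> (shifted \<mu> \<gamma> B) (\<lambda>_. 0))"

section \<open>The base space and its limit sets\<close>

definition translate :: "real \<Rightarrow> (real \<Rightarrow> real^'n^'n) \<Rightarrow> real \<Rightarrow> real^'n^'n" where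
  "translate \<tau> \<omega> = (\<lambda>t. \<omega> (t + \<tau>))"

definition eval_map :: "(real \<Rightarrow> real^'n^'n) \<Rightarrow> real^'n^'n" where
  "eval_map \<omega> = \<omega> 0"

definition orbit_coeff :: "(real \<Rightarrow> real^'n^'n) \<Rightarrow> real \<Rightarrow> real^'n^'n" where
  "orbit_coeff \<omega> = (\<lambda>t. eval_map (translate t \<omega>))"

definition alpha_seq :: "(nat \<Rightarrow> real) \<Rightarrow> bool" where
  "alpha_seq \<tau> \<longleftrightarrow> decseq \<tau> \<and> filterlim \<tau> at_bot sequentially"

definition omega_seq :: "(nat \<Rightarrow> real) \<Rightarrow> bool" where
  "omega_seq \<tau> \<longleftrightarrow> incseq \<tau> \<and> filterlim \<tau> at_top sequentially"

text \<open>The base space is \<open>topspace \<Omega>\<close> with the topology \<open>\<Omega>\<close>. The associated linear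
  skew-product flow is
  \<open>\<Psi>(t,\<omega>,x) = (translate t \<omega>, evolution_operator (orbit_coeff \<omega>) t 0 *v x)\<close>.\<close>

definition skew_product_base :: "(real \<Rightarrow> real^'n^'n) topology \<Rightarrow> bool" where
  "skew_product_base \<Omega> \<longleftrightarrow>
     (\<forall>\<omega>\<in>topspace \<Omega>. locally_integrable \<omega>) \<and>
     (\<forall>\<tau>. \<forall>\<omega>\<in>topspace \<Omega>. translate \<tau> \<omega> \<in> topspace \<Omega>) \<and>
     continuous_map (prod_topology euclideanreal \<Omega>) \<Omega> (\<lambda>(\<tau>, \<omega>). translate \<tau> \<omega>) \<and>
     continuous_map \<Omega> euclidean eval_map \<and>
     (\<forall>\<omega>\<in>topspace \<Omega>. \<forall>\<omega>'\<in>topspace \<Omega>. \<forall>\<tau>.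
        (alpha_seq \<tau> \<or> omega_seq \<tau>) \<and>
        limitin \<Omega> (\<lambda>n. translate (\<tau> n) \<omega>) \<omega>' sequentially \<longrightarrow>
        (AE t in lebesgue. (\<lambda>n. translate (\<tau> n) \<omega> t) \<longlonglongrightarrow> \<omega>' t)) \<and>
     continuous_map (prod_topology \<Omega> (prod_topology euclideanreal euclideanreal)) euclidean
       (\<lambda>(\<omega>, t, s). evolution_operator (orbit_coeff \<omega>) t s)"

definition alpha_limit_set ::
    "(real \<Rightarrow> real^'n^'n) topology \<Rightarrow> (real \<Rightarrow> real^'n^'n) \<Rightarrow> (real \<Rightarrow> real^'n^'n) set" where
  "alpha_limit_set \<Omega> \<omega> =
     {\<omega>' \<in> topspace \<Omega>. \<exists>\<tau>. alpha_seq \<tau> \<and>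
        limitin \<Omega> (\<lambda>n. translate (\<tau> n) \<omega>) \<omega>' sequentially}"

definition omega_limit_set ::
    "(real \<Rightarrow> real^'n^'n) topology \<Rightarrow> (real \<Rightarrow> real^'n^'n) \<Rightarrow> (real \<Rightarrow> real^'n^'n) set" where
  "omega_limit_set \<Omega> \<omega> =
     {\<omega>' \<in> topspace \<Omega>. \<exists>\<tau>. omega_seq \<tau> \<and>
        limitin \<Omega> (\<lambda>n. translate (\<tau> n) \<omega>) \<omega>' sequentially}"

end

(* Along a limit sequence of times, the growth bound of omega shifted by tau_n involves the ratio
   mu(t + tau_n) / mu(s + tau_n), which slowness bounds by a constant independent of t and s as
   tau_n tends to +-infinity. Continuity of the evolution operator in the base point thus makes
   Phi(t, s) of the limit equation uniformly bounded for all t and s. Since Phi(s, t) inverts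
   Phi(t, s), nothing can contract in either time direction, so both P and Id - P would vanish. The
   characterisation of growth through the spectrum rests on the formula
   (mu(t) / mu(s))^(-gamma) Phi(t, s) for the evolution operator of the shifted equation. *)
theory Submission
  imports Defs
begin

section \<open>Primitives of locally integrable functions\<close>

text \<open>\<open>evolution_operator\<close> is a definite description, so every statement about it
  has to wait for existence and uniqueness of solutions with merely locally integrable coefficients.
  Such solutions are differentiable only almost everywhere. \<open>abs_primitive\<close> therefore
  records absolute continuity through the increments of F over all intervals, and the product and
  chain rules become integral identities. It asks for absolute integrability on top of
  \<open>has_integral\<close> because gauge integrability alone is not stable under multiplication
  by continuous functions. In the limit argument, for fixed t and s the comparison ratio
  \<open>u_rate r (t + x) / u_rate r (s + x)\<close> tends to 1. Its speed depends on t and s, but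
  the limit does not, so only the factor \<open>M\<close> survives and the resulting bound is
  uniform.\<close>

definition abs_primitive :: "(real \<Rightarrow> 'a::euclidean_space) \<Rightarrow> (real \<Rightarrow> 'a) \<Rightarrow> bool" where
  "abs_primitive F f \<longleftrightarrow>
     (\<forall>u v. u \<le> v \<longrightarrow> f absolutely_integrable_on {u..v} \<and> (f has_integral (F v - F u)) {u..v})"

lemma abs_primitiveD:
  assumes "abs_primitive F f"
  shows "f absolutely_integrable_on {u..v}"
    and "u \<le> v \<Longrightarrow> (f has_integral (F v - F u)) {u..v}"
    and "u \<le> v \<Longrightarrow> integral {u..v} f = F v - F u"
    and "f integrable_on {u..v}"
proof -
  show A: "f absolutely_integrable_on {u..v}"
    using assms by (cases "u \<le> v") (auto simp: abs_primitive_def)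
  show I: "(f has_integral (F v - F u)) {u..v}" if "u \<le> v"
    using assms that by (auto simp: abs_primitive_def)
  show "integral {u..v} f = F v - F u" if "u \<le> v"
    using I[OF that] by (rule integral_unique)
  show "f integrable_on {u..v}"
    using A by (rule set_lebesgue_integral_eq_integral)
qed

text \<open>\<open>is_evolution_operator\<close> and the indefinite integral in
  \<open>abs_primitive_exists\<close> supply only intervals with one end at the base point. If s
  lies outside {u..v}, integrability passes to the subinterval, and additivity with uniqueness of
  the integral identifies the value.\<close>

lemma has_integral_increment:
  fixes F :: "real \<Rightarrow> 'a::banach"
  assumes r: "\<And>t. s \<le> t \<Longrightarrow> (f has_integral (F t - F s)) {s..t}"
    and l: "\<And>t. t \<le> s \<Longrightarrow> (f has_integral (F s - F t)) {t..s}"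
    and uv: "u \<le> v"
  shows "(f has_integral (F v - F u)) {u..v}"
proof -
  consider "s \<le> u" | "u < s" "s \<le> v" | "v < s" by linarith
  then show ?thesis
  proof cases
    case 1
    then have "f integrable_on {u..v}"
      using integrable_subinterval_real[OF has_integral_integrable[OF r[of v]], of u v] uv by simp
    then obtain I where I: "(f has_integral I) {u..v}"
      unfolding integrable_on_def ..
    have "(f has_integral (F u - F s) + I) {s..v}"
      using has_integral_combine[OF 1 uv r[OF 1] I] .
    then have "(F u - F s) + I = F v - F s"
      using r[of v] 1 uv by (intro has_integral_unique[of f]) auto
    then have "I = F v - F u" by (simp add: algebra_simps)
    then show ?thesis using I by simp
  next
    case 2
    then show ?thesis
      using has_integral_combine[OF _ _ l[of u] r[of v]] by simp
  next
    case 3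
    then have "f integrable_on {u..v}"
      using integrable_subinterval_real[OF has_integral_integrable[OF l[of u]], of u v] uv by simp
    then obtain I where I: "(f has_integral I) {u..v}"
      unfolding integrable_on_def ..
    have vs: "v \<le> s" using 3 by simp
    have "(f has_integral I + (F s - F v)) {u..s}"
      using has_integral_combine[OF uv vs I l[OF vs]] .
    then have "I + (F s - F v) = F s - F u"
      using l[of u] vs uv by (intro has_integral_unique[of f]) auto
    then have "I = F v - F u" by (simp add: algebra_simps)
    then show ?thesis using I by simp
  qed
qed

text \<open>Continuity of a solution is not part of \<open>is_evolution_operator\<close>; it is
  recovered here from the integral equation.\<close>

lemma has_integral_increment_continuous_on:
  fixes F :: "real \<Rightarrow> 'a::banach"
  assumes "\<And>u v. u \<le> v \<Longrightarrow> (f has_integral (F v - F u)) {u..v}"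
  shows "continuous_on S F"
proof -
  have "isCont F t" for t
  proof -
    have "f integrable_on {t-1..t+1}"
      using assms[of "t-1" "t+1"] by auto
    then have "continuous_on {t-1..t+1} (\<lambda>x. F (t-1) + integral {t-1..x} f)"
      by (intro continuous_intros indefinite_integral_continuous_1)
    then have "continuous_on {t-1..t+1} F"
      by (rule continuous_on_eq) (simp add: integral_unique[OF assms])
    then show ?thesis
      using continuous_on_interior[of "{t-1..t+1}" F t] by simp
  qed
  then show ?thesis
    by (simp add: continuous_at_imp_continuous_on)
qed

lemma abs_primitive_exists:
  fixes f :: "real \<Rightarrow> 'a::euclidean_space"
  assumes f: "\<And>u v. f absolutely_integrable_on {u..v}"
  shows "\<exists>F. abs_primitive F f \<and> F t0 = 0"
proof -
  define F where "F t = (if t0 \<le> t then integral {t0..t} f else - integral {t..t0} f)" for t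
  have int: "f integrable_on {u..v}" for u v
    using f by (rule set_lebesgue_integral_eq_integral)
  have "(f has_integral (F v - F u)) {u..v}" if "u \<le> v" for u v
    by (rule has_integral_increment[where s = t0, OF _ _ that])
      (use int in \<open>auto simp: F_def has_integral_integral[symmetric]\<close>)
  then have "abs_primitive F f"
    using f by (auto simp: abs_primitive_def)
  moreover have "F t0 = 0" by (simp add: F_def)
  ultimately show ?thesis by blast
qed

lemma abs_primitive_continuous_on:
  assumes "abs_primitive F f"
  shows "continuous_on S F"
  using has_integral_increment_continuous_on[OF abs_primitiveD(2)[OF assms]] .

lemma abs_primitive_linear:
  assumes "abs_primitive F f" and "linear h"
  shows "abs_primitive (\<lambda>t. h (F t)) (\<lambda>t. h (f t))"
proof -
  have b: "bounded_linear h" using assms(2) by (simp add: linear_conv_bounded_linear)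
  show ?thesis
    unfolding abs_primitive_def
    using absolutely_integrable_linear[OF abs_primitiveD(1)[OF assms(1)] b]
      has_integral_linear[OF abs_primitiveD(2)[OF assms(1)] b]
    by (auto simp: o_def linear_diff[OF assms(2)])
qed

lemma abs_primitive_add_const: "abs_primitive (\<lambda>t. F t + c) f \<longleftrightarrow> abs_primitive F f"
  by (simp add: abs_primitive_def)

text \<open>This takes the place of a Gronwall estimate: uniqueness of solutions below comes from a
  product whose integrand is zero.\<close>

lemma abs_primitive_zero_imp_const:
  assumes "abs_primitive F (\<lambda>t. 0)"
  shows "F u = F v"
  using abs_primitiveD(2)[OF assms, of u v] abs_primitiveD(2)[OF assms, of v u]
  by (cases "u \<le> v") auto

text \<open>A continuous factor is bounded and measurable on a compact interval, so the product is
  dominated by a multiple of the integrable factor.\<close>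

lemma absolutely_integrable_bilinear_continuous:
  fixes h :: "'a::euclidean_space \<Rightarrow> 'b::euclidean_space \<Rightarrow> 'c::euclidean_space"
  assumes "bilinear h" and "continuous_on UNIV F" and "g absolutely_integrable_on {u..v::real}"
  shows "(\<lambda>t. h (F t) (g t)) absolutely_integrable_on {u..v}"
    and "f absolutely_integrable_on {u..v} \<Longrightarrow> continuous_on UNIV G \<Longrightarrow>
           (\<lambda>t. h (f t) (G t)) absolutely_integrable_on {u..v}"
proof -
  \<comment> \<open>Own type variables for \<open>k\<close>: the fact is applied to \<open>h\<close>
    and to its flip, whose argument types are exchanged.\<close>
  have *: "(\<lambda>t. k (H t) (e t)) absolutely_integrable_on {u..v}"
    if "bilinear k" "continuous_on UNIV H" "e absolutely_integrable_on {u..v}"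
    for k :: "'d::euclidean_space \<Rightarrow> 'e::euclidean_space \<Rightarrow> 'c" and H e
  proof (rule absolutely_integrable_bounded_measurable_product[OF that(1) _ _ _ that(3)])
    have c: "continuous_on {u..v} H"
      using that(2) continuous_on_subset by blast
    then show "bounded (H ` {u..v})"
      by (intro compact_imp_bounded compact_continuous_image) auto
    show "H \<in> borel_measurable (lebesgue_on {u..v})"
      by (rule continuous_imp_measurable_on_sets_lebesgue[OF c]) auto
  qed auto
  show "(\<lambda>t. h (F t) (g t)) absolutely_integrable_on {u..v}"
    using * assms by blast
  have "bilinear (\<lambda>x y. h y x)" using assms(1) by (simp add: bilinear_def)
  from *[OF this, of G f]
  show "f absolutely_integrable_on {u..v} \<Longrightarrow> continuous_on UNIV G \<Longrightarrow>
           (\<lambda>t. h (f t) (G t)) absolutely_integrable_on {u..v}" by blast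
qed

text \<open>The increments of \<open>H - \<integral>h\<close> are bounded by \<open>\<epsilon> \<integral>m\<close> on short intervals, hence on
  every interval by subdivision. This replaces almost everywhere differentiation in the
  product and chain rules below.\<close>

lemma abs_primitive_if_local_approx:
  fixes H :: "real \<Rightarrow> 'a::euclidean_space" and m :: "real \<Rightarrow> real"
  assumes h: "\<And>u v. h absolutely_integrable_on {u..v}"
    and m: "\<And>u v. m integrable_on {u..v}"
    and approx: "\<And>a b e. a \<le> b \<Longrightarrow> e > 0 \<Longrightarrow>
       \<exists>d>0. \<forall>u v. a \<le> u \<longrightarrow> u \<le> v \<longrightarrow> v \<le> b \<longrightarrow> v - u < d \<longrightarrow>
         norm (H v - H u - integral {u..v} h) \<le> e * integral {u..v} m"
  shows "abs_primitive H h"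
proof -
  have hi: "h integrable_on {u..v}" for u v
    using h by (rule set_lebesgue_integral_eq_integral)
  have "integral {a..b} h = H b - H a" if ab: "a \<le> b" for a b
  proof -
    have small: "norm (H b - H a - integral {a..b} h) \<le> e * integral {a..b} m" if e: "e > 0" for e
    proof -
      obtain d where d: "d > 0" and loc: "\<And>u v. a \<le> u \<Longrightarrow> u \<le> v \<Longrightarrow> v \<le> b \<Longrightarrow> v - u < d \<Longrightarrow>
         norm (H v - H u - integral {u..v} h) \<le> e * integral {u..v} m"
        using approx[OF ab e] by blast
      obtain n :: nat where n: "real n > (b - a) / d" using reals_Archimedean2 by blast
      have n0: "n > 0"
      proof (rule ccontr)
        assume "\<not> 0 < n"
        then have "(b - a) / d < 0" using n by simp
        then show False using ab d by (simp add: divide_less_0_iff)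
      qed
      define w where "w = (b - a) / n"
      have w: "0 \<le> w" "w < d" "a + real n * w = b"
        using ab n0 n d by (simp_all add: w_def field_simps)
      have "norm (H (a + real i * w) - H a - integral {a..a + real i * w} h)
              \<le> e * integral {a..a + real i * w} m" if "i \<le> n" for i
        using that
      proof (induction i)
        case 0
        then show ?case by simp
      next
        case (Suc i)
        let ?u = "a + real i * w" and ?v = "a + real (Suc i) * w"
        have uv: "a \<le> ?u" "?u \<le> ?v" "?v - ?u < d"
          using w by (simp_all add: algebra_simps)
        have "real (Suc i) * w \<le> real n * w"
          using Suc.prems w by (intro mult_right_mono) auto
        then have vb: "?v \<le> b" using w by simp
        have ch: "integral {a..?v} h = integral {a..?u} h + integral {?u..?v} h"
          and cm: "integral {a..?v} m = integral {a..?u} m + integral {?u..?v} m"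
          using Henstock_Kurzweil_Integration.integral_combine[OF uv(1,2)] hi m by metis+
        have "norm (H ?v - H a - integral {a..?v} h)
            = norm ((H ?u - H a - integral {a..?u} h) + (H ?v - H ?u - integral {?u..?v} h))"
          unfolding ch by (simp add: algebra_simps)
        also have "\<dots> \<le> e * integral {a..?u} m + e * integral {?u..?v} m"
          using Suc loc[OF uv(1,2) vb uv(3)] by (intro norm_triangle_mono) auto
        also have "\<dots> = e * integral {a..?v} m"
          unfolding cm by (simp add: distrib_left)
        finally show ?case .
      qed
      from this[of n] show ?thesis using w by simp
    qed
    have "norm (H b - H a - integral {a..b} h) \<le> 0"
    proof (rule field_le_epsilon)
      fix e :: real assume e: "e > 0"
      let ?I = "\<bar>integral {a..b} m\<bar> + 1"
      have "norm (H b - H a - integral {a..b} h) \<le> (e / ?I) * integral {a..b} m"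
        by (rule small) (use e in auto)
      also have "\<dots> \<le> (e / ?I) * ?I"
        using e by (intro mult_left_mono) auto
      also have "\<dots> = e" by auto
      finally show "norm (H b - H a - integral {a..b} h) \<le> 0 + e" by simp
    qed
    then show ?thesis by simp
  qed
  then show ?thesis
    using h hi by (metis abs_primitive_def has_integral_integral)
qed

section \<open>Product and chain rules for primitives\<close>

lemma abs_primitive_norm_diff_less:
  assumes "abs_primitive F f" and "e > 0"
  shows "\<exists>d>0. \<forall>u v. a \<le> u \<longrightarrow> u \<le> v \<longrightarrow> v \<le> b \<longrightarrow> v - u < d \<longrightarrow> norm (F v - F u) < e"
proof -
  have "uniformly_continuous_on {a..b} F"
    by (intro compact_uniformly_continuous abs_primitive_continuous_on[OF assms(1)]) auto
  then obtain d where "d > 0" and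
    d: "\<And>x y. x \<in> {a..b} \<Longrightarrow> y \<in> {a..b} \<Longrightarrow> dist y x < d \<Longrightarrow> dist (F y) (F x) < e"
    using assms(2) unfolding uniformly_continuous_on_def by metis
  then show ?thesis
    by (intro exI[of _ d]) (auto simp: dist_norm)
qed

text \<open>The increment equals h (F v) (G v - G u) + h (F v - F u) (G u), so freezing F at the
  right end and G at the left end leaves no remainder. Unfreezing them costs at most e times the
  integral of \<open>m\<close>, where F and G oscillate by less than e on short intervals;
  \<open>m\<close> collects the constant K of the bilinear bound and both integrands.\<close>

lemma abs_primitive_product:
  fixes h :: "'a::euclidean_space \<Rightarrow> 'b::euclidean_space \<Rightarrow> 'c::euclidean_space"
  assumes bil: "bilinear h" and F: "abs_primitive F f" and G: "abs_primitive G g"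
  shows "abs_primitive (\<lambda>t. h (F t) (G t)) (\<lambda>t. h (F t) (g t) + h (f t) (G t))"
proof -
  note cF = abs_primitive_continuous_on[OF F] and cG = abs_primitive_continuous_on[OF G]
  note A = absolutely_integrable_bilinear_continuous[OF bil]
  note fi = abs_primitiveD(1)[OF F] and gi = abs_primitiveD(1)[OF G]
  note AI = set_lebesgue_integral_eq_integral(1)
  obtain K where K: "K > 0" "\<And>x y. norm (h x y) \<le> K * norm x * norm y"
    using bilinear_bounded_pos[OF bil] by blast
  define m where "m t = K * (norm (f t) + norm (g t))" for t
  show ?thesis
  proof (rule abs_primitive_if_local_approx[where m = m])
    show "(\<lambda>t. h (F t) (g t) + h (f t) (G t)) absolutely_integrable_on {u..v}" for u v
      by (intro set_integral_add A(1)[OF cF gi] A(2)[OF cF gi fi cG])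
    show mi: "m integrable_on {u..v}" for u v
      unfolding m_def
      by (rule AI) (intro set_integrable_mult_right set_integral_add absolutely_integrable_norm[unfolded o_def] fi gi)
    fix a b e :: real assume ab: "a \<le> b" and e: "e > 0"
    obtain d1 where d1: "d1 > 0"
      "\<And>u v. a \<le> u \<Longrightarrow> u \<le> v \<Longrightarrow> v \<le> b \<Longrightarrow> v - u < d1 \<Longrightarrow> norm (F v - F u) < e"
      using abs_primitive_norm_diff_less[OF F e] by metis
    obtain d2 where d2: "d2 > 0"
      "\<And>u v. a \<le> u \<Longrightarrow> u \<le> v \<Longrightarrow> v \<le> b \<Longrightarrow> v - u < d2 \<Longrightarrow> norm (G v - G u) < e"
      using abs_primitive_norm_diff_less[OF G e] by metis
    have "norm (h (F v) (G v) - h (F u) (G u) - integral {u..v} (\<lambda>t. h (F t) (g t) + h (f t) (G t)))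
            \<le> e * integral {u..v} m"
      if uv: "a \<le> u" "u \<le> v" "v \<le> b" "v - u < min d1 d2" for u v
    proof -
      have lin: "linear (h x)" "linear (\<lambda>x. h x y)" for x y
        using bil by (auto simp: bilinear_def)
      have "((\<lambda>t. h (F v) (g t)) has_integral h (F v) (G v - G u)) {u..v}"
        using has_integral_linear[OF abs_primitiveD(2)[OF G uv(2)], of "h (F v)"] lin(1)
        by (simp add: linear_conv_bounded_linear o_def)
      moreover have "((\<lambda>t. h (f t) (G u)) has_integral h (F v - F u) (G u)) {u..v}"
        using has_integral_linear[OF abs_primitiveD(2)[OF F uv(2)], of "\<lambda>x. h x (G u)"] lin(2)
        by (simp add: linear_conv_bounded_linear o_def)
      ultimately have "((\<lambda>t. h (F v) (g t) + h (f t) (G u)) has_integral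
          h (F v) (G v - G u) + h (F v - F u) (G u)) {u..v}"
        by (rule has_integral_add)
      then have "((\<lambda>t. h (F v) (g t) + h (f t) (G u)) has_integral
          h (F v) (G v) - h (F u) (G u)) {u..v}"
        by (simp add: bilinear_rsub[OF bil] bilinear_lsub[OF bil])
      moreover have i: "(\<lambda>t. h (F t) (g t) + h (f t) (G t)) integrable_on {u..v}"
        by (rule AI) (intro set_integral_add A(1)[OF cF gi] A(2)[OF cF gi fi cG])
      ultimately have "((\<lambda>t. (h (F v) (g t) + h (f t) (G u)) - (h (F t) (g t) + h (f t) (G t)))
          has_integral h (F v) (G v) - h (F u) (G u)
            - integral {u..v} (\<lambda>t. h (F t) (g t) + h (f t) (G t))) {u..v}"
        by (intro has_integral_diff integrable_integral)
      then have *: "((\<lambda>t. h (F v - F t) (g t) - h (f t) (G t - G u))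
          has_integral h (F v) (G v) - h (F u) (G u)
            - integral {u..v} (\<lambda>t. h (F t) (g t) + h (f t) (G t))) {u..v}"
        by (simp add: bilinear_rsub[OF bil] bilinear_lsub[OF bil] algebra_simps)
      have "norm (integral {u..v} (\<lambda>t. h (F v - F t) (g t) - h (f t) (G t - G u)))
          \<le> integral {u..v} (\<lambda>t. e * m t)"
      proof (rule Henstock_Kurzweil_Integration.integral_norm_bound_integral)
        show "(\<lambda>t. h (F v - F t) (g t) - h (f t) (G t - G u)) integrable_on {u..v}"
          using * by blast
        show "(\<lambda>t. e * m t) integrable_on {u..v}"
          by (rule integrable_on_mult_right[OF mi])
        fix t assume t: "t \<in> {u..v}"
        have "norm (h (F v - F t) (g t) - h (f t) (G t - G u))
            \<le> K * norm (F v - F t) * norm (g t) + K * norm (f t) * norm (G t - G u)"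
          using K(2) by (meson add_mono norm_triangle_ineq4 order_trans)
        also have "\<dots> \<le> K * e * norm (g t) + K * norm (f t) * e"
          using t uv K(1) less_imp_le[OF d1(2)[of t v]] less_imp_le[OF d2(2)[of u t]]
          by (intro add_mono mult_right_mono mult_left_mono) auto
        also have "\<dots> = e * m t" by (simp add: m_def algebra_simps)
        finally show "norm (h (F v - F t) (g t) - h (f t) (G t - G u)) \<le> e * m t" .
      qed
      then show ?thesis
        using integral_unique[OF *] by simp
    qed
    then show "\<exists>d>0. \<forall>u v. a \<le> u \<longrightarrow> u \<le> v \<longrightarrow> v \<le> b \<longrightarrow> v - u < d \<longrightarrow>
       norm (h (F v) (G v) - h (F u) (G u) - integral {u..v} (\<lambda>t. h (F t) (g t) + h (f t) (G t)))
            \<le> e * integral {u..v} m"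
      using d1(1) d2(1) by (intro exI[of _ "min d1 d2"]) auto
  qed
qed

text \<open>The mean value theorem gives an intermediate value between F u and F v, and the
  intermediate value theorem writes it as F w with w in {u..v}. The derivative frozen at F w then
  differs from the one at F t by less than e, by uniform continuity of the composition on
  {a..b}.\<close>

lemma abs_primitive_chain:
  fixes F f \<phi> \<phi>' :: "real \<Rightarrow> real"
  assumes F: "abs_primitive F f"
    and d\<phi>: "\<And>x. (\<phi> has_real_derivative \<phi>' x) (at x)" and c\<phi>': "continuous_on UNIV \<phi>'"
  shows "abs_primitive (\<lambda>t. \<phi> (F t)) (\<lambda>t. \<phi>' (F t) * f t)"
proof (rule abs_primitive_if_local_approx)
  note cF = abs_primitive_continuous_on[OF F]
  note fi = abs_primitiveD(1)[OF F]
  note AI = set_lebesgue_integral_eq_integral(1)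
  have cc: "continuous_on UNIV (\<lambda>t. \<phi>' (F t))"
    using continuous_on_compose2[OF c\<phi>' cF] by auto
  show abs: "(\<lambda>t. \<phi>' (F t) * f t) absolutely_integrable_on {u..v}" for u v
    using absolutely_integrable_bilinear_continuous(1)[OF bilinear_times cc fi] .
  show mi: "(\<lambda>t. \<bar>f t\<bar>) integrable_on {u..v}" for u v
    using AI[OF absolutely_integrable_norm[OF fi]] by (simp add: o_def)
  fix a b e :: real assume ab: "a \<le> b" and e: "e > 0"
  have "uniformly_continuous_on {a..b} (\<lambda>t. \<phi>' (F t))"
    using cc by (intro compact_uniformly_continuous) (auto intro: continuous_on_subset)
  then obtain d where d0: "d > 0" and d: "\<And>x y. x \<in> {a..b} \<Longrightarrow> y \<in> {a..b} \<Longrightarrow>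
      dist y x < d \<Longrightarrow> dist (\<phi>' (F y)) (\<phi>' (F x)) < e"
    using e unfolding uniformly_continuous_on_def by metis
  have "norm (\<phi> (F v) - \<phi> (F u) - integral {u..v} (\<lambda>t. \<phi>' (F t) * f t)) \<le> e * integral {u..v} (\<lambda>t. \<bar>f t\<bar>)"
    if uv: "a \<le> u" "u \<le> v" "v \<le> b" "v - u < d" for u v
  proof -
    have "\<exists>w\<in>{u..v}. \<phi> (F v) - \<phi> (F u) = (F v - F u) * \<phi>' (F w)"
    proof -
      consider "F u < F v" | "F u = F v" | "F v < F u" by linarith
      then show ?thesis
      proof cases
        case 1
        obtain z where z: "F u < z" "z < F v" "\<phi> (F v) - \<phi> (F u) = (F v - F u) * \<phi>' z"
          using MVT2[OF 1 d\<phi>] by blast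
        obtain w where "u \<le> w" "w \<le> v" "F w = z"
          using IVT'[of F u z v] z uv(2) cF by auto
        then show ?thesis using z by auto
      next
        case 2
        then show ?thesis using uv by auto
      next
        case 3
        obtain z where z: "F v < z" "z < F u" "\<phi> (F u) - \<phi> (F v) = (F u - F v) * \<phi>' z"
          using MVT2[OF 3 d\<phi>] by blast
        obtain w where "u \<le> w" "w \<le> v" "F w = z"
          using IVT2'[of F v z u] z uv(2) cF by auto
        then show ?thesis using z by (intro bexI[of _ w]) (auto simp: algebra_simps)
      qed
    qed
    then obtain w where w: "w \<in> {u..v}" "\<phi> (F v) - \<phi> (F u) = \<phi>' (F w) * (F v - F u)"
      by (auto simp: mult.commute)
    have "((\<lambda>t. \<phi>' (F w) * f t) has_integral \<phi>' (F w) * (F v - F u)) {u..v}"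
      using abs_primitiveD(2)[OF F uv(2)] by (rule has_integral_mult_right)
    moreover have "(\<lambda>t. \<phi>' (F t) * f t) integrable_on {u..v}"
      by (rule AI[OF abs])
    ultimately have *: "((\<lambda>t. \<phi>' (F w) * f t - \<phi>' (F t) * f t) has_integral
       \<phi> (F v) - \<phi> (F u) - integral {u..v} (\<lambda>t. \<phi>' (F t) * f t)) {u..v}"
      unfolding w(2) by (intro has_integral_diff integrable_integral)
    have "norm (integral {u..v} (\<lambda>t. \<phi>' (F w) * f t - \<phi>' (F t) * f t)) \<le> integral {u..v} (\<lambda>t. e * \<bar>f t\<bar>)"
    proof (rule Henstock_Kurzweil_Integration.integral_norm_bound_integral)
      show "(\<lambda>t. \<phi>' (F w) * f t - \<phi>' (F t) * f t) integrable_on {u..v}"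
        using * by blast
      show "(\<lambda>t. e * \<bar>f t\<bar>) integrable_on {u..v}"
        by (rule integrable_on_mult_right[OF mi])
      fix t assume t: "t \<in> {u..v}"
      have "\<bar>\<phi>' (F w) - \<phi>' (F t)\<bar> < e"
        using d[of t w] t w(1) uv by (auto simp: dist_real_def)
      then show "norm (\<phi>' (F w) * f t - \<phi>' (F t) * f t) \<le> e * \<bar>f t\<bar>"
        by (simp add: left_diff_distrib[symmetric] abs_mult mult_right_mono)
    qed
    then show ?thesis using integral_unique[OF *] by simp
  qed
  then show "\<exists>d>0. \<forall>u v. a \<le> u \<longrightarrow> u \<le> v \<longrightarrow> v \<le> b \<longrightarrow> v - u < d \<longrightarrow>
     norm (\<phi> (F v) - \<phi> (F u) - integral {u..v} (\<lambda>t. \<phi>' (F t) * f t)) \<le> e * integral {u..v} (\<lambda>t. \<bar>f t\<bar>)"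
    using d0 by (intro exI[of _ d]) auto
qed

lemma abs_primitive_diff:
  assumes "abs_primitive F f" and "abs_primitive G g"
  shows "abs_primitive (\<lambda>t. F t - G t) (\<lambda>t. f t - g t)"
  unfolding abs_primitive_def
proof (intro allI impI conjI)
  fix u v :: real assume uv: "u \<le> v"
  show "(\<lambda>t. f t - g t) absolutely_integrable_on {u..v}"
    by (intro set_integral_diff abs_primitiveD(1)[OF assms(1)] abs_primitiveD(1)[OF assms(2)])
  show "((\<lambda>t. f t - g t) has_integral F v - G v - (F u - G u)) {u..v}"
    using has_integral_diff[OF abs_primitiveD(2)[OF assms(1) uv] abs_primitiveD(2)[OF assms(2) uv]]
    by (simp add: algebra_simps)
qed

section \<open>Existence and uniqueness of the evolution operator\<close>

lemma matrix_mult_scaleR: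
  fixes A C :: "real^'n^'n"
  shows "(c *\<^sub>R A) ** C = c *\<^sub>R (A ** C)" and "A ** (c *\<^sub>R C) = c *\<^sub>R (A ** C)"
  by (simp_all add: vec_eq_iff matrix_matrix_mult_def sum_distrib_left mult_ac)

lemma bilinear_matrix_mult: "bilinear ((**) :: real^'n^'n \<Rightarrow> real^'n^'n \<Rightarrow> real^'n^'n)"
  unfolding bilinear_def
  by (auto intro!: linearI simp: matrix_mult_scaleR matrix_add_ldistrib
      vec_eq_iff matrix_matrix_mult_def sum.distrib sum_distrib_left algebra_simps)

lemma linear_matrix_transpose: "linear (transpose :: real^'n^'n \<Rightarrow> real^'n^'n)"
  by (auto intro!: linearI simp: transpose_def vec_eq_iff)

text \<open>Picard's operator is a contraction in the norm weighted by \<open>exp (-2\<bar>\<beta> t\<bar>)\<close>; this is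
  the integral estimate behind the factor 1/2.\<close>

lemma norm_primitive_le_weight:
  fixes F f :: "real \<Rightarrow> 'a::euclidean_space"
  assumes F: "abs_primitive F f" and F0: "F 0 = 0"
    and \<beta>: "abs_primitive \<beta> b" and \<beta>0: "\<beta> 0 = 0" and b: "\<And>t. 0 \<le> b t"
    and le: "\<And>t. norm (f t) \<le> C * (b t * exp (2 * \<bar>\<beta> t\<bar>))"
  shows "norm (F t) \<le> C * (exp (2 * \<bar>\<beta> t\<bar>) - 1) / 2"
proof -
  have mono: "\<beta> u \<le> \<beta> v" if "u \<le> v" for u v
    using has_integral_nonneg[OF abs_primitiveD(2)[OF \<beta> that]] b by simp
  \<comment> \<open>Used with c = 2 to the right of 0 and c = -2 to the left. There \<beta> is
    nonnegative and nonpositive respectively, so the weight is smooth in \<beta> on each side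
    although the absolute value is not.\<close>
  have chain: "((\<lambda>t. exp (c * \<beta> t) * c * b t) has_integral exp (c * \<beta> v) - exp (c * \<beta> u)) {u..v}"
    if "u \<le> v" for u v c
    by (rule abs_primitiveD(2)[OF _ that], rule abs_primitive_chain[OF \<beta>, where \<phi> = "\<lambda>x. exp (c * x)"])
      (auto intro!: derivative_eq_intros continuous_intros)
  note bound = Henstock_Kurzweil_Integration.integral_norm_bound_integral[OF abs_primitiveD(4)[OF F]]
  show ?thesis
  proof (cases "0 \<le> t")
    case True
    have I: "((\<lambda>t. (C / 2) * (exp (2 * \<beta> t) * 2 * b t)) has_integral
        (C / 2) * (exp (2 * \<beta> t) - exp (2 * \<beta> 0))) {0..t}"
      by (intro has_integral_mult_right chain True)
    have "norm (integral {0..t} f) \<le> integral {0..t} (\<lambda>t. (C / 2) * (exp (2 * \<beta> t) * 2 * b t))"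
    proof (rule bound)
      show "(\<lambda>t. (C / 2) * (exp (2 * \<beta> t) * 2 * b t)) integrable_on {0..t}" using I by blast
      fix x assume "x \<in> {0..t}"
      then have "0 \<le> \<beta> x" using mono[of 0 x] \<beta>0 by simp
      then show "norm (f x) \<le> (C / 2) * (exp (2 * \<beta> x) * 2 * b x)"
        using le[of x] by (simp add: mult_ac)
    qed
    then show ?thesis
      unfolding integral_unique[OF I] abs_primitiveD(3)[OF F True]
      using mono[OF True] \<beta>0 F0 by simp
  next
    case False
    then have t: "t \<le> 0" by simp
    have I: "((\<lambda>t. (- C / 2) * (exp (-2 * \<beta> t) * -2 * b t)) has_integral
        (- C / 2) * (exp (-2 * \<beta> 0) - exp (-2 * \<beta> t))) {t..0}"
      by (intro has_integral_mult_right chain t)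
    have "norm (integral {t..0} f) \<le> integral {t..0} (\<lambda>t. (- C / 2) * (exp (-2 * \<beta> t) * -2 * b t))"
    proof (rule bound)
      show "(\<lambda>t. (- C / 2) * (exp (-2 * \<beta> t) * -2 * b t)) integrable_on {t..0}" using I by blast
      fix x assume "x \<in> {t..0}"
      then have "\<beta> x \<le> 0" using mono[of x 0] \<beta>0 by simp
      then show "norm (f x) \<le> (- C / 2) * (exp (-2 * \<beta> x) * -2 * b x)"
        using le[of x] by (simp add: mult_ac)
    qed
    then show ?thesis
      unfolding integral_unique[OF I] abs_primitiveD(3)[OF F t]
      using mono[OF t] \<beta>0 F0 by (simp add: algebra_simps)
  qed
qed

text \<open>The weight makes Picard's operator a contraction on the whole real line at once, so the
  global solution is a single fixed point and no local solutions have to be glued.\<close>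

lemma linear_ode_solution_exists:
  fixes B :: "real \<Rightarrow> real^'n^'n"
  assumes B: "locally_integrable B"
  shows "\<exists>X :: real \<Rightarrow> real^'n^'n. abs_primitive X (\<lambda>t. B t ** X t) \<and> X 0 = mat 1"
proof -
  have Bi: "B absolutely_integrable_on {u..v}" for u v
    using B by (simp add: locally_integrable_def)
  obtain K where K: "K > 0" "\<And>(x :: real^'n^'n) (y :: real^'n^'n). norm (x ** y) \<le> K * norm x * norm y"
    using bilinear_bounded_pos[OF bilinear_matrix_mult[where 'n = 'n]] by metis
  define b where "b t = K * norm (B t)" for t
  have b0: "0 \<le> b t" for t using K(1) by (simp add: b_def)
  have "b absolutely_integrable_on {u..v}" for u v
    unfolding b_def
    by (intro set_integrable_mult_right absolutely_integrable_norm[unfolded o_def] Bi)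
  then obtain \<beta> where \<beta>: "abs_primitive \<beta> b" "\<beta> 0 = 0"
    using abs_primitive_exists by blast
  define E where "E t = exp (2 * \<bar>\<beta> t\<bar>)" for t
  have E1: "1 \<le> E t" for t by (simp add: E_def)
  have Epos: "0 < E t" for t by (simp add: E_def)
  have contE: "continuous_on UNIV E"
    unfolding E_def by (intro continuous_intros abs_primitive_continuous_on[OF \<beta>(1)])
  \<comment> \<open>\<open>Y\<close> stands for the candidate solution divided by the weight, X = E
    Y. The weighted supremum norm of X is thus the ordinary norm of the type of bounded continuous
    functions.\<close>
  define g where "g Y t = B t ** (E t *\<^sub>R apply_bcontfun Y t)" for Y :: "real \<Rightarrow>\<^sub>C (real^'n^'n)" and t
  have gi: "g Y absolutely_integrable_on {u..v}" for Y u v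
    unfolding g_def
    by (intro absolutely_integrable_bilinear_continuous(2)[OF bilinear_matrix_mult
          continuous_on_const[of _ 0] Bi Bi] continuous_intros contE) auto
  define J where "J Y = (SOME F. abs_primitive F (g Y) \<and> F 0 = 0)" for Y
  have J: "abs_primitive (J Y) (g Y)" "J Y 0 = 0" for Y
    unfolding J_def using someI_ex[OF abs_primitive_exists[OF gi, of Y 0]] by blast+
  define T where "T Y t = (1 / E t) *\<^sub>R (mat 1 + J Y t)" for Y t
  have Jdiff: "norm (J Y t - J Z t) \<le> dist Y Z * (E t - 1) / 2" for Y Z t
    unfolding E_def
  proof (rule norm_primitive_le_weight[OF abs_primitive_diff[OF J(1) J(1)] _ \<beta> b0])
    fix t
    have "g Y t - g Z t = B t ** (E t *\<^sub>R (apply_bcontfun Y t - apply_bcontfun Z t))"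
      unfolding g_def by (simp add: bilinear_rsub[OF bilinear_matrix_mult] scaleR_diff_right)
    also have "norm \<dots> \<le> K * norm (B t) * norm (E t *\<^sub>R (apply_bcontfun Y t - apply_bcontfun Z t))"
      by (rule K)
    also have "\<dots> = b t * E t * dist (apply_bcontfun Y t) (apply_bcontfun Z t)"
      using Epos[of t] by (simp add: b_def dist_norm)
    also have "\<dots> \<le> b t * E t * dist Y Z"
      using b0 Epos[of t] by (intro mult_left_mono dist_bounded) auto
    finally show "norm (g Y t - g Z t) \<le> dist Y Z * (b t * exp (2 * \<bar>\<beta> t\<bar>))"
      by (simp add: E_def mult_ac)
  qed (simp add: J)
  \<comment> \<open>Comparison with \<open>J 0\<close> turns the Lipschitz estimate
    \<open>Jdiff\<close> into a growth bound, which is what keeps \<open>T Y\<close>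
    bounded.\<close>
  have "g 0 = (\<lambda>t. 0)"
    by (simp add: g_def fun_eq_iff matrix_matrix_mult_def vec_eq_iff)
  then have J0: "J 0 t = 0" for t
    using abs_primitive_zero_imp_const[of "J 0" t 0] J[of 0] by simp
  have Tb: "T Y \<in> bcontfun" for Y
  proof (rule bcontfun_normI)
    show "continuous_on UNIV (T Y)"
      unfolding T_def using Epos
      by (intro continuous_intros contE abs_primitive_continuous_on[OF J(1)]) (metis less_irrefl)
    fix t
    have "norm (T Y t) = norm (mat 1 + (J Y t - J 0 t)) / E t"
      using Epos[of t] by (simp add: T_def J0)
    also have "\<dots> \<le> (norm (mat 1 :: real^'n^'n) + dist Y 0 * (E t - 1) / 2) / E t"
      using Epos[of t] Jdiff[of Y t 0]
      by (intro divide_right_mono order_trans[OF norm_triangle_ineq] add_mono) auto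
    also have "\<dots> \<le> (norm (mat 1 :: real^'n^'n) * E t + dist Y 0 * E t) / E t"
    proof (intro divide_right_mono add_mono)
      show "norm (mat 1 :: real^'n^'n) \<le> norm (mat 1 :: real^'n^'n) * E t"
        using E1[of t] mult_left_mono[OF E1[of t], of "norm (mat 1 :: real^'n^'n)"] by simp
      have "dist Y 0 * ((E t - 1) / 2) \<le> dist Y 0 * E t"
        using E1[of t] by (intro mult_left_mono) auto
      then show "dist Y 0 * (E t - 1) / 2 \<le> dist Y 0 * E t" by simp
    qed (use Epos[of t] in auto)
    also have "\<dots> = norm (mat 1 :: real^'n^'n) + dist Y 0"
      using Epos[of t] by (simp add: field_simps)
    finally show "norm (T Y t) \<le> norm (mat 1 :: real^'n^'n) + dist Y 0" .
  qed
  have app: "apply_bcontfun (Bcontfun (T Y)) = T Y" for Y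
    by (rule Bcontfun_inverse[OF Tb])
  have "\<exists>!Y. Bcontfun (T Y) = Y"
  proof (rule banach_fix_type[where c = "1/2"])
    show "\<forall>Y Z. dist (Bcontfun (T Y)) (Bcontfun (T Z)) \<le> 1/2 * dist Y Z"
    proof (intro allI dist_bound)
      fix Y Z t
      have "dist (T Y t) (T Z t) = norm (J Y t - J Z t) / E t"
        using Epos[of t] by (simp add: T_def dist_norm scaleR_diff_right[symmetric])
      also have "\<dots> \<le> (dist Y Z * (E t - 1) / 2) / E t"
        using Epos[of t] by (intro divide_right_mono Jdiff) auto
      also have "\<dots> \<le> (dist Y Z * E t / 2) / E t"
        using Epos[of t] by (intro divide_right_mono mult_left_mono) auto
      also have "\<dots> = 1/2 * dist Y Z"
        using Epos[of t] by simp
      finally show "dist (apply_bcontfun (Bcontfun (T Y)) t) (apply_bcontfun (Bcontfun (T Z)) t)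
          \<le> 1/2 * dist Y Z"
        by (simp add: app)
    qed
  qed auto
  then obtain Y where "Bcontfun (T Y) = Y" by blast
  then have TY: "apply_bcontfun Y = T Y" using app by metis
  define X where "X t = J Y t + mat 1" for t
  have X: "E t *\<^sub>R apply_bcontfun Y t = X t" for t
    using Epos[of t] by (simp add: TY T_def X_def add.commute)
  have "g Y = (\<lambda>t. B t ** X t)"
    by (intro ext) (simp add: g_def X)
  then have "abs_primitive X (\<lambda>t. B t ** X t)"
    using J(1)[of Y] unfolding X_def by (simp add: abs_primitive_add_const)
  moreover have "X 0 = mat 1" by (simp add: X_def J)
  ultimately show ?thesis by blast
qed

text \<open>The transpose of the solution of the adjoint equation \<open>Z' = -B\<^sup>T Z\<close> inverts \<open>X\<close>, so that
  \<open>Y Z\<close> is constant for every other solution \<open>Z\<close>.\<close>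

lemma fundamental_solution:
  fixes B :: "real \<Rightarrow> real^'n^'n"
  assumes B: "locally_integrable B"
  obtains X Y :: "real \<Rightarrow> real^'n^'n" where "abs_primitive X (\<lambda>t. B t ** X t)"
    and "\<And>t. X t ** Y t = mat 1" and "\<And>t. Y t ** X t = mat 1"
    and "\<And>(Z :: real \<Rightarrow> real^'n^'n) s t. abs_primitive Z (\<lambda>t. B t ** Z t) \<Longrightarrow> Z t = X t ** (Y s ** Z s)"
proof -
  obtain X where X: "abs_primitive X (\<lambda>t. B t ** X t)" "X 0 = mat 1"
    using linear_ode_solution_exists[OF B] by blast
  have lin: "linear (\<lambda>M :: real^'n^'n. - transpose M)"
    using linear_compose_neg[OF linear_matrix_transpose] .
  have "locally_integrable (\<lambda>t. - transpose (B t))"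
    unfolding locally_integrable_def
  proof (intro allI)
    fix a c
    show "(\<lambda>t. - transpose (B t)) absolutely_integrable_on {a..c}"
      using absolutely_integrable_linear[where f = B and h = "\<lambda>M. - transpose M"] B lin
      by (simp add: locally_integrable_def linear_conv_bounded_linear o_def)
  qed
  then obtain Z where Z: "abs_primitive Z (\<lambda>t. - transpose (B t) ** Z t)" "Z 0 = mat 1"
    using linear_ode_solution_exists by blast
  define Y where "Y t = transpose (Z t)" for t
  have neg: "(- M) ** N = - (M ** N)" for M N :: "real^'n^'n"
    using bilinear_lneg[OF bilinear_matrix_mult] .
  have "transpose (- transpose (B t) ** Z t) = - (Y t ** B t)" for t
    by (simp add: neg linear_neg[OF linear_matrix_transpose] matrix_transpose_mul Y_def)
  then have Y: "abs_primitive Y (\<lambda>t. - (Y t ** B t))"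
    using abs_primitive_linear[OF Z(1) linear_matrix_transpose] by (simp add: Y_def[abs_def])
  have const: "Y t ** V t = Y s ** V s" if V: "abs_primitive V (\<lambda>t. B t ** V t)" for V :: "real \<Rightarrow> real^'n^'n" and s t
  proof (rule abs_primitive_zero_imp_const[where F = "\<lambda>t. Y t ** V t"])
    show "abs_primitive (\<lambda>t. Y t ** V t) (\<lambda>t. 0)"
      using abs_primitive_product[OF bilinear_matrix_mult Y V] by (simp add: neg matrix_mul_assoc)
  qed
  have YX: "Y t ** X t = mat 1" for t
    using const[OF X(1), of t 0] by (simp add: X Y_def Z transpose_mat)
  then have XY: "X t ** Y t = mat 1" for t
    using matrix_left_right_inverse by blast
  have "V t = X t ** (Y s ** V s)" if "abs_primitive V (\<lambda>t. B t ** V t)" for V :: "real \<Rightarrow> real^'n^'n" and s t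
    using const[OF that, of s t] XY by (simp add: matrix_mul_assoc)
  then show ?thesis using that X(1) XY YX by blast
qed

text \<open>The content is the forward direction. The degenerate interval {s..s} yields the initial
  value, the integral equation yields continuity of the solution, and continuity upgrades the gauge
  integral of the definition to an absolutely convergent one.\<close>

lemma is_evolution_operator_iff:
  fixes B :: "real \<Rightarrow> real^'n^'n"
  assumes B: "locally_integrable B"
  shows "is_evolution_operator B \<Phi> \<longleftrightarrow>
     (\<forall>s. abs_primitive (\<lambda>t. \<Phi> t s) (\<lambda>t. B t ** \<Phi> t s) \<and> \<Phi> s s = mat 1)"
    (is "_ \<longleftrightarrow> ?R")
proof
  assume E: "is_evolution_operator B \<Phi>"
  show ?R
  proof
    fix s
    have "((\<lambda>u. B u ** \<Phi> u s) has_integral (\<Phi> s s - mat 1)) {s..s}"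
      using E unfolding is_evolution_operator_def by (metis order_refl)
    then have 1: "\<Phi> s s = mat 1"
      using has_integral_unique[OF _ has_integral_refl(2)] by force
    have I: "((\<lambda>u. B u ** \<Phi> u s) has_integral (\<Phi> v s - \<Phi> u s)) {u..v}" if "u \<le> v" for u v
      by (rule has_integral_increment[where s = s, OF _ _ that])
        (use E 1 in \<open>auto simp: is_evolution_operator_def\<close>)
    have "continuous_on UNIV (\<lambda>t. \<Phi> t s)"
      using has_integral_increment_continuous_on[OF I] .
    moreover have Bi: "B absolutely_integrable_on {u..v}" for u v
      using B by (simp add: locally_integrable_def)
    ultimately have "(\<lambda>t. B t ** \<Phi> t s) absolutely_integrable_on {u..v}" for u v
      by (intro absolutely_integrable_bilinear_continuous(2)[OF bilinear_matrix_mult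
          continuous_on_const[of _ 0] Bi Bi])
    then show "abs_primitive (\<lambda>t. \<Phi> t s) (\<lambda>t. B t ** \<Phi> t s) \<and> \<Phi> s s = mat 1"
      using I 1 by (auto simp: abs_primitive_def)
  qed
next
  assume R: ?R
  show "is_evolution_operator B \<Phi>"
    unfolding is_evolution_operator_def
  proof (intro allI conjI impI)
    fix s t
    show "((\<lambda>u. B u ** \<Phi> u s) has_integral (\<Phi> t s - mat 1)) {s..t}" if "s \<le> t"
      using R abs_primitiveD(2)[OF _ that] by (metis (no_types, lifting))
    show "((\<lambda>u. B u ** \<Phi> u s) has_integral (mat 1 - \<Phi> t s)) {t..s}" if "t \<le> s"
      using R abs_primitiveD(2)[OF _ that] by (metis (no_types, lifting))
  qed
qed

text \<open>The operator is X(t) times the inverse of X(s). This gives the definite description in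
  \<open>evolution_operator\<close> its meaning.\<close>

lemma ex1_evolution_operator:
  fixes B :: "real \<Rightarrow> real^'n^'n"
  assumes B: "locally_integrable B"
  shows "\<exists>!\<Phi>. is_evolution_operator B \<Phi>"
proof -
  obtain X Y :: "real \<Rightarrow> real^'n^'n" where X: "abs_primitive X (\<lambda>t. B t ** X t)"
    and XY: "\<And>t. X t ** Y t = mat 1" and YX: "\<And>t. Y t ** X t = mat 1"
    and gen: "\<And>(Z :: real \<Rightarrow> real^'n^'n) s t. abs_primitive Z (\<lambda>t. B t ** Z t) \<Longrightarrow> Z t = X t ** (Y s ** Z s)"
    by (fact fundamental_solution[OF B])
  have "linear (\<lambda>M :: real^'n^'n. M ** Y s)" for s
    using bilinear_matrix_mult unfolding bilinear_def by blast
  from abs_primitive_linear[OF X this]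
  have "is_evolution_operator B (\<lambda>t s. X t ** Y s)"
    by (simp add: is_evolution_operator_iff[OF B] XY matrix_mul_assoc)
  moreover have "\<Phi> = (\<lambda>t s. X t ** Y s)" if "is_evolution_operator B \<Phi>" for \<Phi>
  proof (intro ext)
    fix t s
    have \<Phi>: "abs_primitive (\<lambda>t. \<Phi> t s) (\<lambda>t. B t ** \<Phi> t s)" "\<Phi> s s = mat 1"
      using that by (auto simp: is_evolution_operator_iff[OF B])
    show "\<Phi> t s = X t ** Y s"
      using gen[OF \<Phi>(1), of t s] \<Phi>(2) by simp
  qed
  ultimately show ?thesis by blast
qed

section \<open>Cocycle and translation properties of the evolution operator\<close>

lemma evolution_operator_eqI:
  fixes B :: "real \<Rightarrow> real^'n^'n"
  assumes "locally_integrable B" and "is_evolution_operator B \<Phi>"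
  shows "evolution_operator B = \<Phi>"
  unfolding evolution_operator_def
  using ex1_evolution_operator[OF assms(1)] assms(2) by (metis the1_equality)

lemma is_evolution_operator_evolution_operator:
  fixes B :: "real \<Rightarrow> real^'n^'n"
  assumes "locally_integrable B"
  shows "is_evolution_operator B (evolution_operator B)"
  unfolding evolution_operator_def using theI'[OF ex1_evolution_operator[OF assms]] .

lemma evolution_operator_cocycle:
  fixes B :: "real \<Rightarrow> real^'n^'n"
  assumes B: "locally_integrable B"
  shows "evolution_operator B t s ** evolution_operator B s r = evolution_operator B t r"
proof -
  obtain X Y :: "real \<Rightarrow> real^'n^'n" where X: "abs_primitive X (\<lambda>t. B t ** X t)"
    and XY: "\<And>t. X t ** Y t = mat 1" and YX: "\<And>t. Y t ** X t = mat 1"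
    and gen: "\<And>(Z :: real \<Rightarrow> real^'n^'n) s t. abs_primitive Z (\<lambda>t. B t ** Z t) \<Longrightarrow> Z t = X t ** (Y s ** Z s)"
    by (fact fundamental_solution[OF B])
  have "abs_primitive (\<lambda>t. evolution_operator B t s) (\<lambda>t. B t ** evolution_operator B t s)"
    "evolution_operator B s s = mat 1" for s
    using is_evolution_operator_evolution_operator[OF B] by (auto simp: is_evolution_operator_iff[OF B])
  from gen[OF this(1)] this(2) have eq: "evolution_operator B t s = X t ** Y s" for t s
    by (metis matrix_mul_rid)
  have "X t ** Y s ** (X s ** Y r) = X t ** (Y s ** X s) ** Y r"
    by (simp add: matrix_mul_assoc)
  then show ?thesis by (simp add: eq YX)
qed

lemma evolution_operator_refl:
  fixes B :: "real \<Rightarrow> real^'n^'n"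
  assumes "locally_integrable B"
  shows "evolution_operator B s s = mat 1"
  using is_evolution_operator_evolution_operator[OF assms]
  by (simp add: is_evolution_operator_iff[OF assms])

text \<open>Uniqueness reduces this to a change of variables in the integral equation. It carries
  growth bounds for \<omega> over to all its translates.\<close>

lemma evolution_operator_translate:
  fixes \<omega> :: "real \<Rightarrow> real^'n^'n"
  assumes "locally_integrable \<omega>" and "locally_integrable (translate \<tau> \<omega>)"
  shows "evolution_operator (translate \<tau> \<omega>) t s = evolution_operator \<omega> (t + \<tau>) (s + \<tau>)"
proof -
  have E: "is_evolution_operator \<omega> (evolution_operator \<omega>)"
    by (rule is_evolution_operator_evolution_operator[OF assms(1)])
  have sh: "((\<lambda>u. translate \<tau> \<omega> u ** evolution_operator \<omega> (u + \<tau>) (s + \<tau>)) has_integral I) {a..b} \<longleftrightarrow>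
      ((\<lambda>u. \<omega> u ** evolution_operator \<omega> u (s + \<tau>)) has_integral I) {a + \<tau>..b + \<tau>}" for s a b I
    using has_integral_shift_Icc_real[of "\<lambda>u. \<omega> u ** evolution_operator \<omega> u (s + \<tau>)" \<tau> I a b]
    by (simp add: translate_def o_def add.commute)
  have "is_evolution_operator (translate \<tau> \<omega>) (\<lambda>t s. evolution_operator \<omega> (t + \<tau>) (s + \<tau>))"
    using E unfolding is_evolution_operator_def sh by simp
  from evolution_operator_eqI[OF assms(2) this] show ?thesis by (rule fun_cong[THEN fun_cong])
qed

section \<open>Growth rates and the shifted equation\<close>

lemma growth_rateD:
  assumes "growth_rate \<mu>"
  shows "0 < \<mu> t" and "t \<le> s \<Longrightarrow> \<mu> t \<le> \<mu> s" and "\<mu> 0 = 1"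
    and "(\<mu> has_real_derivative deriv \<mu> t) (at t)"
    and "filterlim \<mu> at_top at_top" and "(\<mu> \<longlongrightarrow> 0) at_bot"
proof -
  show "(\<mu> has_real_derivative deriv \<mu> t) (at t)"
    using assms by (metis growth_rate_def real_differentiable_def DERIV_imp_deriv)
  show "t \<le> s \<Longrightarrow> \<mu> t \<le> \<mu> s"
    using assms by (auto simp: growth_rate_def strict_mono_less_eq)
qed (use assms in \<open>auto simp: growth_rate_def\<close>)

text \<open>\<open>deriv \<mu>\<close> need not be continuous; being nonnegative, it is nevertheless absolutely
  integrable.\<close>

lemma abs_primitive_ln_growth_rate:
  assumes "growth_rate \<mu>"
  shows "abs_primitive (\<lambda>t. ln (\<mu> t)) (\<lambda>t. deriv \<mu> t / \<mu> t)"
proof -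
  note \<mu> = growth_rateD[OF assms]
  have d: "((\<lambda>t. ln (\<mu> t)) has_real_derivative deriv \<mu> t / \<mu> t) (at t)" for t
    using \<mu>(1)[of t] by (auto intro!: derivative_eq_intros \<mu>(4) simp: divide_inverse mult.commute)
  have I: "((\<lambda>t. deriv \<mu> t / \<mu> t) has_integral ln (\<mu> v) - ln (\<mu> u)) {u..v}" if "u \<le> v" for u v
    using that has_field_derivative_at_within[OF d]
    by (intro fundamental_theorem_of_calculus) (auto simp: has_real_derivative_iff_has_vector_derivative)
  have "mono_on UNIV \<mu>" using \<mu>(2) by (auto simp: mono_on_def)
  then have "0 \<le> deriv \<mu> t" for t
    by (rule mono_on_imp_deriv_nonneg[OF _ \<mu>(4)]) simp
  then have "0 \<le> deriv \<mu> t / \<mu> t" for t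
    using \<mu>(1)[of t] by simp
  then show ?thesis
    using I unfolding abs_primitive_def
    by (auto intro!: nonnegative_absolutely_integrable_1)
qed

lemma locally_integrable_shifted:
  fixes B :: "real \<Rightarrow> real^'n^'n"
  assumes "growth_rate \<mu>" and "locally_integrable B"
  shows "locally_integrable (shifted \<mu> \<gamma> B)"
  unfolding locally_integrable_def shifted_def
proof (intro allI set_integral_diff)
  fix a b
  show "B absolutely_integrable_on {a..b}"
    using assms(2) by (simp add: locally_integrable_def)
  have "linear (\<lambda>x. (\<gamma> * x) *\<^sub>R (mat 1 :: real^'n^'n))"
    by (auto intro!: linearI simp: algebra_simps)
  from absolutely_integrable_linear[OF abs_primitiveD(1)[OF abs_primitive_ln_growth_rate[OF assms(1)]]
      this[unfolded linear_conv_bounded_linear]]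
  show "(\<lambda>t. (\<gamma> * (deriv \<mu> t / \<mu> t)) *\<^sub>R (mat 1 :: real^'n^'n)) absolutely_integrable_on {a..b}"
    by (simp add: o_def)
qed

text \<open>The scalar factor is itself a solution of the scalar equation with coefficient -\<gamma>
  times the logarithmic derivative of \<mu>; the product rule and uniqueness do the rest.\<close>

lemma evolution_operator_shifted:
  fixes B :: "real \<Rightarrow> real^'n^'n"
  assumes \<mu>: "growth_rate \<mu>" and B: "locally_integrable B"
  shows "evolution_operator (shifted \<mu> \<gamma> B) t s = (\<mu> t / \<mu> s) powr (- \<gamma>) *\<^sub>R evolution_operator B t s"
proof -
  define \<Phi> where "\<Phi> = evolution_operator B"
  have \<Phi>: "abs_primitive (\<lambda>t. \<Phi> t s) (\<lambda>t. B t ** \<Phi> t s)" "\<Phi> s s = mat 1" for s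
    using is_evolution_operator_evolution_operator[OF B]
    by (auto simp: is_evolution_operator_iff[OF B] \<Phi>_def)
  define f where "f t s = (\<mu> t / \<mu> s) powr (- \<gamma>)" for t s
  \<comment> \<open>This form shows f as a smooth function of the primitive
    \<open>ln (\<mu> t)\<close>, as \<open>abs_primitive_chain\<close> requires.\<close>
  have f_eq: "f t s = exp (- \<gamma> * (ln (\<mu> t) - ln (\<mu> s)))" for t s
    using growth_rateD(1)[OF \<mu>, of t] growth_rateD(1)[OF \<mu>, of s]
    by (simp add: f_def powr_def ln_div)
  have f: "abs_primitive (\<lambda>t. f t s) (\<lambda>t. f t s * - \<gamma> * (deriv \<mu> t / \<mu> t))" for s
    unfolding f_eq
    by (rule abs_primitive_chain[OF abs_primitive_ln_growth_rate[OF \<mu>],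
          where \<phi> = "\<lambda>x. exp (- \<gamma> * (x - ln (\<mu> s)))"])
      (auto intro!: derivative_eq_intros continuous_intros)
  have bil: "bilinear ((*\<^sub>R) :: real \<Rightarrow> real^'n^'n \<Rightarrow> real^'n^'n)"
    using bounded_bilinear_scaleR by (simp add: bilinear_conv_bounded_bilinear)
  have eq: "f t s *\<^sub>R (B t ** \<Phi> t s) + (f t s * - \<gamma> * (deriv \<mu> t / \<mu> t)) *\<^sub>R \<Phi> t s
      = shifted \<mu> \<gamma> B t ** (f t s *\<^sub>R \<Phi> t s)" for t s
    by (simp add: shifted_def bilinear_lsub[OF bilinear_matrix_mult] matrix_mult_scaleR scaleR_diff_right mult_ac)
  have "abs_primitive (\<lambda>t. f t s *\<^sub>R \<Phi> t s) (\<lambda>t. shifted \<mu> \<gamma> B t ** (f t s *\<^sub>R \<Phi> t s))" for s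
    using abs_primitive_product[OF bil f \<Phi>(1), of s s] by (simp only: eq)
  moreover have "f s s *\<^sub>R \<Phi> s s = mat 1" for s
    using growth_rateD(1)[OF \<mu>, of s] by (simp add: f_def \<Phi>(2))
  ultimately have "is_evolution_operator (shifted \<mu> \<gamma> B) (\<lambda>t s. f t s *\<^sub>R \<Phi> t s)"
    by (simp add: is_evolution_operator_iff[OF locally_integrable_shifted[OF \<mu> B]])
  from evolution_operator_eqI[OF locally_integrable_shifted[OF \<mu> B] this]
  show ?thesis by (simp add: f_def \<Phi>_def)
qed

section \<open>Growth and the spectrum at infinity\<close>

lemma mnorm_nonneg: "0 \<le> mnorm A"
  unfolding mnorm_def by (rule onorm_pos_le) simp

lemma norm_le_mnorm: "norm (A *v x) \<le> mnorm A * norm x"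
  unfolding mnorm_def by (rule onorm) simp

lemma mnorm_leI: "(\<And>x. norm (A *v x) \<le> c * norm x) \<Longrightarrow> mnorm A \<le> c"
  unfolding mnorm_def by (rule onorm_le)

lemma mnorm_scaleR: "mnorm (c *\<^sub>R A) = \<bar>c\<bar> * mnorm A"
  unfolding mnorm_def scaleR_matrix_vector_assoc[symmetric] by (rule onorm_scaleR) simp

lemma mnorm_mat_1: "mnorm (mat 1 :: real^'n^'n) = 1"
  by (simp add: mnorm_def onorm_id)

lemma mnorm_zero: "mnorm 0 = 0"
  by (simp add: mnorm_def onorm_zero)

lemma mnorm_le_zero_iff: "mnorm A \<le> 0 \<longleftrightarrow> A = 0"
proof
  assume "mnorm A \<le> 0"
  then have "norm (A *v x) \<le> 0" for x
    using norm_le_mnorm[of A x] by (meson mult_nonpos_nonneg norm_ge_zero order_trans)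
  then show "A = 0" by (simp add: matrix_eq)
qed (simp add: mnorm_zero)

lemma mnorm_mult: "mnorm (A ** C) \<le> mnorm A * mnorm C"
proof (rule mnorm_leI)
  fix x
  have "norm (A ** C *v x) \<le> mnorm A * norm (C *v x)"
    using norm_le_mnorm[of A "C *v x"] by (simp add: matrix_vector_mul_assoc)
  also have "\<dots> \<le> mnorm A * (mnorm C * norm x)"
    by (intro mult_left_mono norm_le_mnorm mnorm_nonneg)
  finally show "norm (A ** C *v x) \<le> mnorm A * mnorm C * norm x" by (simp add: mult.assoc)
qed

text \<open>The bound varies with n because it will contain a ratio of \<open>u_rate\<close> values
  of which only the limit is controlled. Testing on a fixed vector reduces the claim to real
  sequences.\<close>

lemma mnorm_limit_le:
  fixes A :: "nat \<Rightarrow> real^'n^'n"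
  assumes A: "A \<longlonglongrightarrow> A'" and c: "c \<longlonglongrightarrow> c'" and le: "\<And>n. mnorm (A n) \<le> c n"
  shows "mnorm A' \<le> c'"
proof (rule mnorm_leI)
  fix x :: "real^'n"
  have "linear (\<lambda>M :: real^'n^'n. M *v x)"
    by (auto intro!: linearI simp: matrix_vector_mult_add_rdistrib scaleR_matrix_vector_assoc)
  then have "(\<lambda>n. A n *v x) \<longlonglongrightarrow> A' *v x"
    using bounded_linear.tendsto A by (simp add: linear_conv_bounded_linear)
  then have "(\<lambda>n. norm (A n *v x)) \<longlonglongrightarrow> norm (A' *v x)" by (rule tendsto_norm)
  moreover have "(\<lambda>n. c n * norm x) \<longlonglongrightarrow> c' * norm x" by (intro tendsto_intros c)
  ultimately show "norm (A' *v x) \<le> c' * norm x"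
    using le by (intro tendsto_le[OF sequentially_bot])
      (auto intro!: always_eventually order_trans[OF norm_le_mnorm] mult_right_mono)
qed

text \<open>On the diagonal the ratio is 1, so the exponents 0, a and -a agree there. This needs
  \<mu> to be nonzero, since division by 0 gives 0 and \<open>0 powr 0\<close> is 0.\<close>

lemma has_growth_iff:
  assumes \<mu>: "growth_rate \<mu>"
  shows "has_growth \<mu> B \<longleftrightarrow> (\<exists>L a. L \<ge> 1 \<and> a > 0 \<and>
     (\<forall>t s. s \<le> t \<longrightarrow> mnorm (evolution_operator B t s) \<le> L * (\<mu> t / \<mu> s) powr a) \<and>
     (\<forall>t s. t \<le> s \<longrightarrow> mnorm (evolution_operator B t s) \<le> L * (\<mu> t / \<mu> s) powr (- a)))"
proof -
  have 1: "\<mu> t \<noteq> 0" for t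
    using growth_rateD(1)[OF \<mu>, of t] by simp
  have "(\<forall>t s. m t s \<le> L * (\<mu> t / \<mu> s) powr (sgn (t - s) * a)) \<longleftrightarrow>
     (\<forall>t s. s \<le> t \<longrightarrow> m t s \<le> L * (\<mu> t / \<mu> s) powr a) \<and>
     (\<forall>t s. t \<le> s \<longrightarrow> m t s \<le> L * (\<mu> t / \<mu> s) powr (- a))" (is "?l \<longleftrightarrow> ?r")
    for m :: "real \<Rightarrow> real \<Rightarrow> real" and L a
  proof
    assume l: ?l
    have "m t s \<le> L * (\<mu> t / \<mu> s) powr a" if "s \<le> t" for t s
      using l[rule_format, of t s] that 1 by (cases "s = t") auto
    moreover have "m t s \<le> L * (\<mu> t / \<mu> s) powr (- a)" if "t \<le> s" for t s
      using l[rule_format, of t s] that 1 by (cases "s = t") auto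
    ultimately show ?r by blast
  next
    assume r: ?r
    show ?l
    proof (intro allI)
      fix t s
      show "m t s \<le> L * (\<mu> t / \<mu> s) powr (sgn (t - s) * a)"
        using r[THEN conjunct1, rule_format, of s t] r[THEN conjunct2, rule_format, of t s] 1
        by (cases t s rule: linorder_cases) auto
    qed
  qed
  then show ?thesis unfolding has_growth_def by simp
qed

text \<open>Shifting by \<gamma> lowers the exponent by \<gamma>, which is why \<open>a\<close> may
  have any sign: the shift a + 1 leaves exponent -1. The estimate for Id - P concerns the zero
  matrix and holds with exponent 1.\<close>

lemma pinfty_notin_spectrum_iff:
  fixes B :: "real \<Rightarrow> real^'n^'n"
  assumes \<mu>: "growth_rate \<mu>" and B: "locally_integrable B"
  shows "pinfty_notin_spectrum \<mu> B \<longleftrightarrow> (\<exists>K a. K \<ge> 1 \<and>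
     (\<forall>t s. s \<le> t \<longrightarrow> mnorm (evolution_operator B t s) \<le> K * (\<mu> t / \<mu> s) powr a))"
    (is "_ \<longleftrightarrow> ?R")
proof
  have mu: "\<mu> t \<noteq> 0" for t using growth_rateD(1)[OF \<mu>, of t] by simp
  {
    assume "pinfty_notin_spectrum \<mu> B"
    then obtain \<gamma> K \<alpha> where K: "K \<ge> 1" and
      le: "\<And>t s. s \<le> t \<Longrightarrow> (\<mu> t / \<mu> s) powr (- \<gamma>) * mnorm (evolution_operator B t s)
            \<le> K * (\<mu> t / \<mu> s) powr \<alpha>"
      unfolding pinfty_notin_spectrum_def uniform_dichotomy_with_def dichotomy_with_def
        evolution_operator_shifted[OF \<mu> B]
      by (auto simp: mnorm_scaleR mu)
    have "mnorm (evolution_operator B t s) \<le> K * (\<mu> t / \<mu> s) powr (\<alpha> + \<gamma>)" if "s \<le> t" for t s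
    proof -
      have "mnorm (evolution_operator B t s)
          = (\<mu> t / \<mu> s) powr \<gamma> * ((\<mu> t / \<mu> s) powr (- \<gamma>) * mnorm (evolution_operator B t s))"
        by (simp add: mult.assoc[symmetric] powr_add[symmetric] mu)
      also have "\<dots> \<le> (\<mu> t / \<mu> s) powr \<gamma> * (K * (\<mu> t / \<mu> s) powr \<alpha>)"
        by (intro mult_left_mono le that) auto
      finally show ?thesis by (simp add: powr_add mult_ac)
    qed
    then show ?R using K by blast
  }
  {
    assume ?R
    then obtain K a where K: "K \<ge> 1" and
      le: "\<And>t s. s \<le> t \<Longrightarrow> mnorm (evolution_operator B t s) \<le> K * (\<mu> t / \<mu> s) powr a"
      by blast
    have bound: "(\<mu> t / \<mu> s) powr (- (a + 1)) * mnorm (evolution_operator B t s) \<le> K * (\<mu> t / \<mu> s) powr (- 1)"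
      if "s \<le> t" for t s
    proof -
      have "(\<mu> t / \<mu> s) powr (- (a + 1)) * mnorm (evolution_operator B t s)
          \<le> (\<mu> t / \<mu> s) powr (- (a + 1)) * (K * (\<mu> t / \<mu> s) powr a)"
        by (intro mult_left_mono le that) auto
      also have "\<dots> = K * ((\<mu> t / \<mu> s) powr (- (a + 1)) * (\<mu> t / \<mu> s) powr a)" by simp
      finally show ?thesis by (simp only: powr_add[symmetric]) simp
    qed
    have "dichotomy_with \<mu> (shifted \<mu> (a + 1) B) (\<lambda>_. mat 1) 0 0"
      unfolding dichotomy_with_def evolution_operator_shifted[OF \<mu> B]
      by (intro conjI allI; (rule exI[of _ K], rule exI[of _ "-1 :: real"], rule exI[of _ "1 :: real"])?)
        (use K bound in \<open>auto simp: mnorm_scaleR mnorm_zero mu\<close>)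
    then show "pinfty_notin_spectrum \<mu> B"
      unfolding pinfty_notin_spectrum_def uniform_dichotomy_with_def by blast
  }
qed

text \<open>Mirror image of \<open>pinfty_notin_spectrum_iff\<close>: the exponent now has to become
  positive, and the shift a - 1 leaves 1.\<close>

lemma minfty_notin_spectrum_iff:
  fixes B :: "real \<Rightarrow> real^'n^'n"
  assumes \<mu>: "growth_rate \<mu>" and B: "locally_integrable B"
  shows "minfty_notin_spectrum \<mu> B \<longleftrightarrow> (\<exists>K a. K \<ge> 1 \<and>
     (\<forall>t s. t \<le> s \<longrightarrow> mnorm (evolution_operator B t s) \<le> K * (\<mu> t / \<mu> s) powr a))"
    (is "_ \<longleftrightarrow> ?R")
proof
  have mu: "\<mu> t \<noteq> 0" for t using growth_rateD(1)[OF \<mu>, of t] by simp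
  {
    assume "minfty_notin_spectrum \<mu> B"
    then obtain \<gamma> K \<beta> where K: "K \<ge> 1" and
      le: "\<And>t s. t \<le> s \<Longrightarrow> (\<mu> t / \<mu> s) powr (- \<gamma>) * mnorm (evolution_operator B t s)
            \<le> K * (\<mu> t / \<mu> s) powr \<beta>"
      unfolding minfty_notin_spectrum_def uniform_dichotomy_with_def dichotomy_with_def
        evolution_operator_shifted[OF \<mu> B]
      by (auto simp: mnorm_scaleR mu)
    have "mnorm (evolution_operator B t s) \<le> K * (\<mu> t / \<mu> s) powr (\<beta> + \<gamma>)" if "t \<le> s" for t s
    proof -
      have "mnorm (evolution_operator B t s)
          = (\<mu> t / \<mu> s) powr \<gamma> * ((\<mu> t / \<mu> s) powr (- \<gamma>) * mnorm (evolution_operator B t s))"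
        by (simp add: mult.assoc[symmetric] powr_add[symmetric] mu)
      also have "\<dots> \<le> (\<mu> t / \<mu> s) powr \<gamma> * (K * (\<mu> t / \<mu> s) powr \<beta>)"
        by (intro mult_left_mono le that) auto
      finally show ?thesis by (simp add: powr_add mult_ac)
    qed
    then show ?R using K by blast
  }
  {
    assume ?R
    then obtain K a where K: "K \<ge> 1" and
      le: "\<And>t s. t \<le> s \<Longrightarrow> mnorm (evolution_operator B t s) \<le> K * (\<mu> t / \<mu> s) powr a"
      by blast
    have bound: "(\<mu> t / \<mu> s) powr (- (a - 1)) * mnorm (evolution_operator B t s) \<le> K * (\<mu> t / \<mu> s) powr 1"
      if "t \<le> s" for t s
    proof -
      have "(\<mu> t / \<mu> s) powr (- (a - 1)) * mnorm (evolution_operator B t s)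
          \<le> (\<mu> t / \<mu> s) powr (- (a - 1)) * (K * (\<mu> t / \<mu> s) powr a)"
        by (intro mult_left_mono le that) auto
      also have "\<dots> = K * ((\<mu> t / \<mu> s) powr (- (a - 1)) * (\<mu> t / \<mu> s) powr a)" by simp
      finally show ?thesis by (simp only: powr_add[symmetric]) simp
    qed
    have "dichotomy_with \<mu> (shifted \<mu> (a - 1) B) (\<lambda>_. 0) 0 0"
      unfolding dichotomy_with_def evolution_operator_shifted[OF \<mu> B]
      by (intro conjI allI; (rule exI[of _ K], rule exI[of _ "-1 :: real"], rule exI[of _ "1 :: real"])?)
        (use K bound in \<open>auto simp: mnorm_scaleR mnorm_zero mu\<close>)
    then show "minfty_notin_spectrum \<mu> B"
      unfolding minfty_notin_spectrum_def uniform_dichotomy_with_def by blast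
  }
qed

lemma has_growth_iff_infty_notin_spectrum:
  fixes B :: "real \<Rightarrow> real^'n^'n"
  assumes \<mu>: "growth_rate \<mu>" and B: "locally_integrable B"
  shows "has_growth \<mu> B \<longleftrightarrow> pinfty_notin_spectrum \<mu> B \<and> minfty_notin_spectrum \<mu> B"
proof
  assume "has_growth \<mu> B"
  then show "pinfty_notin_spectrum \<mu> B \<and> minfty_notin_spectrum \<mu> B"
    unfolding has_growth_iff[OF \<mu>] pinfty_notin_spectrum_iff[OF \<mu> B] minfty_notin_spectrum_iff[OF \<mu> B]
    by blast
next
  assume "pinfty_notin_spectrum \<mu> B \<and> minfty_notin_spectrum \<mu> B"
  then obtain K a K' a' where K: "K \<ge> 1" "K' \<ge> 1" and
      le: "\<And>t s. s \<le> t \<Longrightarrow> mnorm (evolution_operator B t s) \<le> K * (\<mu> t / \<mu> s) powr a" and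
      le': "\<And>t s. t \<le> s \<Longrightarrow> mnorm (evolution_operator B t s) \<le> K' * (\<mu> t / \<mu> s) powr a'"
    unfolding pinfty_notin_spectrum_iff[OF \<mu> B] minfty_notin_spectrum_iff[OF \<mu> B] by blast
  note \<mu>' = growth_rateD(1,2)[OF \<mu>]
  define L where "L = max K K'"
  \<comment> \<open>Both one-sided exponents may have any sign. Passing to \<open>A\<close> forward
    and to -A backward only weakens the bounds, as the ratio is at least 1 for s \<le> t and at most
    1 for t \<le> s; the entry 1 makes \<open>A\<close> positive.\<close>
  define A where "A = max 1 (max a (- a'))"
  have "mnorm (evolution_operator B t s) \<le> L * (\<mu> t / \<mu> s) powr A" if "s \<le> t" for t s
  proof -
    have "1 \<le> \<mu> t / \<mu> s" using \<mu>'(1)[of s] \<mu>'(2)[OF that] by simp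
    then have "K * (\<mu> t / \<mu> s) powr a \<le> L * (\<mu> t / \<mu> s) powr A"
      using K by (intro mult_mono powr_mono) (auto simp: L_def A_def)
    then show ?thesis using le[OF that] by simp
  qed
  moreover have "mnorm (evolution_operator B t s) \<le> L * (\<mu> t / \<mu> s) powr (- A)" if "t \<le> s" for t s
  proof -
    have "\<mu> t / \<mu> s \<le> 1" "0 \<le> \<mu> t / \<mu> s"
      using \<mu>'(1)[of s] \<mu>'(1)[of t] \<mu>'(2)[OF that] by simp_all
    then have "K' * (\<mu> t / \<mu> s) powr a' \<le> L * (\<mu> t / \<mu> s) powr (- A)"
      using K by (intro mult_mono powr_mono') (auto simp: L_def A_def)
    then show ?thesis using le'[OF that] by simp
  qed
  moreover have "L \<ge> 1" "A > 0" using K by (auto simp: L_def A_def)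
  ultimately show "has_growth \<mu> B"
    unfolding has_growth_iff[OF \<mu>] by blast
qed

section \<open>Limit points of a slowly growing equation\<close>

text \<open>By the mean value theorem the difference is controlled by the derivative at the smaller
  argument, and that derivative decays because r - 1 is negative.\<close>

lemma powr_shift_diff_tendsto_0:
  fixes r c d :: real
  assumes "0 < r" and "r < 1"
  shows "((\<lambda>x. (x + c) powr r - (x + d) powr r) \<longlongrightarrow> 0) at_top"
proof -
  have lip: "\<bar>(x + c) powr r - (x + d) powr r\<bar> \<le> \<bar>c - d\<bar> * (r * (x + min c d) powr (r - 1))"
    if "x + min c d > 0" for x
  proof -
    have *: "v powr r - u powr r \<le> (v - u) * (r * u powr (r - 1)) \<and> u powr r \<le> v powr r"
      if "0 < u" "u \<le> v" for u v
    proof (cases "u = v")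
      case False
      have "((\<lambda>z. z powr r) has_real_derivative r * z powr (r - 1)) (at z)" if "u \<le> z" for z
        using that \<open>0 < u\<close> by (auto intro!: derivative_eq_intros)
      then obtain z where "u < z" "v powr r - u powr r = (v - u) * (r * z powr (r - 1))"
        using MVT2[of u v "\<lambda>z. z powr r" "\<lambda>z. r * z powr (r - 1)"] \<open>u \<le> v\<close> False by auto
      moreover have "z powr (r - 1) \<le> u powr (r - 1)"
        using \<open>u < z\<close> \<open>0 < u\<close> assms by (intro powr_mono2') auto
      ultimately show ?thesis
        using assms \<open>u \<le> v\<close> \<open>0 < u\<close> by (auto intro!: mult_left_mono powr_mono2)
    qed auto
    show ?thesis
    proof (cases "c \<le> d")
      case True
      then show ?thesis using *[of "x + c" "x + d"] that by auto
    next
      case False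
      then show ?thesis using *[of "x + d" "x + c"] that by auto
    qed
  qed
  have "filterlim (\<lambda>x. x + min c d) at_top at_top"
    using filterlim_tendsto_add_at_top[OF tendsto_const filterlim_ident, of "min c d"]
    by (simp add: add.commute)
  then have lim: "((\<lambda>x. \<bar>c - d\<bar> * (r * (x + min c d) powr (r - 1))) \<longlongrightarrow> \<bar>c - d\<bar> * (r * 0)) at_top"
    using assms by (intro tendsto_intros tendsto_neg_powr) auto
  have "\<forall>\<^sub>F x in at_top. x + min c d > 0"
    using eventually_gt_at_top[of "- min c d"] by eventually_elim linarith
  then have "\<forall>\<^sub>F x in at_top. norm ((x + c) powr r - (x + d) powr r)
      \<le> \<bar>c - d\<bar> * (r * (x + min c d) powr (r - 1))"
    by eventually_elim (use lip in simp)
  then show ?thesis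
    by (rule Lim_null_comparison) (use lim in simp)
qed

text \<open>The exponent of \<open>u_rate\<close> is sublinear, so a bounded time difference is negligible far
  out. This is the only place where \<open>r < 1\<close> matters.\<close>

lemma u_rate_ratio_tendsto_1:
  assumes r: "0 < r" "r < 1"
  shows "((\<lambda>x. u_rate r (t + x) / u_rate r (s + x)) \<longlongrightarrow> 1) at_top"
    and "((\<lambda>x. u_rate r (t + x) / u_rate r (s + x)) \<longlongrightarrow> 1) at_bot"
proof -
  have "((\<lambda>x. exp ((x + (t + 1)) powr r - (x + (s + 1)) powr r)) \<longlongrightarrow> exp 0) at_top"
    by (intro tendsto_exp powr_shift_diff_tendsto_0 r)
  moreover have "\<forall>\<^sub>F x in at_top. exp ((x + (t + 1)) powr r - (x + (s + 1)) powr r)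
      = u_rate r (t + x) / u_rate r (s + x)"
    using eventually_gt_at_top[of "\<bar>t\<bar> + \<bar>s\<bar>"]
  proof eventually_elim
    case (elim x)
    then have "0 < t + x" "0 < s + x" by linarith+
    then show ?case by (simp add: u_rate_def exp_diff[symmetric] ac_simps)
  qed
  ultimately show "((\<lambda>x. u_rate r (t + x) / u_rate r (s + x)) \<longlongrightarrow> 1) at_top"
    using Lim_transform_eventually by fastforce
  \<comment> \<open>Reflection x to -x. For large x both t - x and s - x are negative, so their
    absolute values plus 1 are x + (1 - t) and x + (1 - s), and the sign in \<open>u_rate\<close>
    exchanges the two terms.\<close>
  have "((\<lambda>x. exp ((x + (1 - s)) powr r - (x + (1 - t)) powr r)) \<longlongrightarrow> exp 0) at_top"
    by (intro tendsto_exp powr_shift_diff_tendsto_0 r)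
  moreover have "\<forall>\<^sub>F x in at_top. exp ((x + (1 - s)) powr r - (x + (1 - t)) powr r)
      = u_rate r (t - x) / u_rate r (s - x)"
    using eventually_gt_at_top[of "\<bar>t\<bar> + \<bar>s\<bar>"]
  proof eventually_elim
    case (elim x)
    then have "t - x < 0" "s - x < 0" by linarith+
    then show ?case by (simp add: u_rate_def exp_diff[symmetric] algebra_simps)
  qed
  ultimately have "((\<lambda>x. u_rate r (t - x) / u_rate r (s - x)) \<longlongrightarrow> 1) at_top"
    using Lim_transform_eventually by fastforce
  then show "((\<lambda>x. u_rate r (t + x) / u_rate r (s + x)) \<longlongrightarrow> 1) at_bot"
    by (simp add: filterlim_at_bot_mirror)
qed

section \<open>Passage to the limit equation\<close>

lemma orbit_coeff_eq: "orbit_coeff \<omega> = \<omega>"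
  by (simp add: orbit_coeff_def eval_map_def translate_def)

lemma evolution_operator_limit:
  assumes base: "skew_product_base \<Omega>" and lim: "limitin \<Omega> \<xi> \<omega>' F"
  shows "((\<lambda>n. evolution_operator (\<xi> n) t s) \<longlongrightarrow> evolution_operator \<omega>' t s) F"
proof -
  have "continuous_map \<Omega> (prod_topology \<Omega> (prod_topology euclideanreal euclideanreal))
      (\<lambda>\<omega>. (\<omega>, t, s))"
    by (intro continuous_map_pairedI) auto
  moreover have "continuous_map (prod_topology \<Omega> (prod_topology euclideanreal euclideanreal)) euclidean
       (\<lambda>(\<omega>, t, s). evolution_operator \<omega> t s)"
    using base unfolding skew_product_base_def orbit_coeff_eq by blast
  ultimately have "continuous_map \<Omega> euclidean ((\<lambda>(\<omega>, t, s). evolution_operator \<omega> t s) \<circ> (\<lambda>\<omega>. (\<omega>, t, s)))"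
    by (rule continuous_map_compose)
  from continuous_map_limit[OF this lim] show ?thesis
    by (simp add: o_def)
qed

lemma limit_evolution_operator_bounded:
  fixes \<Omega> :: "(real \<Rightarrow> real^'n^'n) topology"
  assumes base: "skew_product_base \<Omega>" and \<omega>: "\<omega> \<in> topspace \<Omega>"
    and \<mu>: "growth_rate \<mu>" and slow: "slow \<mu>" and growth: "has_growth \<mu> \<omega>"
    and \<omega>': "\<omega>' \<in> alpha_limit_set \<Omega> \<omega> \<union> omega_limit_set \<Omega> \<omega>"
  shows "\<exists>C. \<forall>t s. mnorm (evolution_operator \<omega>' t s) \<le> C"
proof -
  note pos = growth_rateD(1)[OF \<mu>]
  have li: "locally_integrable (translate \<tau> \<omega>)" "locally_integrable \<omega>" for \<tau>
    using base \<omega> by (auto simp: skew_product_base_def)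
  obtain r M where r: "0 < r" "r < 1" and M: "M \<ge> 1" and
    sl: "\<And>t s. t \<ge> s \<Longrightarrow> \<mu> t / \<mu> s \<le> M * (u_rate r t / u_rate r s)"
    using slow unfolding slow_def by blast
  obtain L a where L: "L \<ge> 1" and a: "a > 0" and
    up: "\<And>t s. s \<le> t \<Longrightarrow> mnorm (evolution_operator \<omega> t s) \<le> L * (\<mu> t / \<mu> s) powr a" and
    down: "\<And>t s. t \<le> s \<Longrightarrow> mnorm (evolution_operator \<omega> t s) \<le> L * (\<mu> t / \<mu> s) powr (- a)"
    using growth unfolding has_growth_iff[OF \<mu>] by blast
  obtain \<tau> where \<tau>: "filterlim \<tau> at_bot sequentially \<or> filterlim \<tau> at_top sequentially"
    and lim: "limitin \<Omega> (\<lambda>n. translate (\<tau> n) \<omega>) \<omega>' sequentially"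
    using \<omega>' by (auto simp: alpha_limit_set_def omega_limit_set_def alpha_seq_def omega_seq_def)
  have "mnorm (evolution_operator \<omega>' t s) \<le> L * (M * 1) powr a" for t s
  proof (rule mnorm_limit_le[OF evolution_operator_limit[OF base lim]])
    \<comment> \<open>Slowness bounds only ratios of a later to an earlier value. For t < s the
      exponent -a inverts the ratio, so \<open>max\<close> and \<open>min\<close> cover both orders
      with one estimate.\<close>
    let ?q = "\<lambda>n. u_rate r (max t s + \<tau> n) / u_rate r (min t s + \<tau> n)"
    have "?q \<longlonglongrightarrow> 1"
      using \<tau> filterlim_compose[OF u_rate_ratio_tendsto_1(1)[OF r]]
        filterlim_compose[OF u_rate_ratio_tendsto_1(2)[OF r]] by blast
    then show "(\<lambda>n. L * (M * ?q n) powr a) \<longlonglongrightarrow> L * (M * 1) powr a"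
      using M by (intro tendsto_intros) auto
    fix n
    have "mnorm (evolution_operator (translate (\<tau> n) \<omega>) t s)
        = mnorm (evolution_operator \<omega> (t + \<tau> n) (s + \<tau> n))"
      by (simp add: evolution_operator_translate li)
    also have "\<dots> \<le> L * (\<mu> (max t s + \<tau> n) / \<mu> (min t s + \<tau> n)) powr a"
    proof (cases "s \<le> t")
      case True
      then show ?thesis using up[of "s + \<tau> n" "t + \<tau> n"] by (simp add: max.absorb1 min.absorb2)
    next
      case False
      have "(\<mu> (t + \<tau> n) / \<mu> (s + \<tau> n)) powr (- a) = (\<mu> (s + \<tau> n) / \<mu> (t + \<tau> n)) powr a"
        using pos[of "t + \<tau> n"] pos[of "s + \<tau> n"]
        by (simp add: powr_minus inverse_powr[symmetric])
      then show ?thesis using False down[of "t + \<tau> n" "s + \<tau> n"] by (simp add: max_def min_def)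
    qed
    also have "\<dots> \<le> L * (M * ?q n) powr a"
      using L a sl[of "min t s + \<tau> n" "max t s + \<tau> n"] pos[THEN less_imp_le]
      by (intro mult_left_mono powr_mono2) auto
    finally show "mnorm (evolution_operator (translate (\<tau> n) \<omega>) t s) \<le> L * (M * ?q n) powr a" .
  qed
  then show ?thesis by blast
qed

text \<open>If \<open>\<Phi>(t,0)\<close> and its inverse \<open>\<Phi>(0,t)\<close> are both bounded, no nonzero vector can be
  contracted as \<open>t \<rightarrow> \<infinity>\<close> or as \<open>t \<rightarrow> -\<infinity>\<close>. At the base time 0 the nonuniform factor
  \<open>\<sigma>(0)\<close> equals 1.\<close>

lemma bounded_evolution_no_dichotomy:
  fixes B :: "real \<Rightarrow> real^'n^'n"
  assumes B: "locally_integrable B" and bd: "\<And>t s. mnorm (evolution_operator B t s) \<le> C"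
    and \<sigma>: "growth_rate \<sigma>"
  shows "\<not> nonuniform_dichotomy \<sigma> B"
proof
  assume "nonuniform_dichotomy \<sigma> B"
  then obtain P \<theta> \<nu> K \<alpha> \<beta> where \<alpha>: "\<alpha> < 0" and \<beta>: "\<beta> > 0" and
    f: "\<And>t s. t \<ge> s \<Longrightarrow> mnorm (evolution_operator B t s ** P s)
             \<le> K * (\<sigma> t / \<sigma> s) powr \<alpha> * \<sigma> s powr (sgn s * \<theta>)" and
    g: "\<And>t s. t \<le> s \<Longrightarrow> mnorm (evolution_operator B t s ** (mat 1 - P s))
             \<le> K * (\<sigma> t / \<sigma> s) powr \<beta> * \<sigma> s powr (sgn s * \<nu>)"
    unfolding nonuniform_dichotomy_def dichotomy_with_def by blast
  have \<sigma>0: "\<sigma> 0 = 1" using growth_rateD(3)[OF \<sigma>] .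
  have C0: "0 \<le> C" using order_trans[OF mnorm_nonneg bd] .
  \<comment> \<open>A general filter covers both time directions: P 0 decays along
    \<open>at_top\<close>, Id - P 0 along \<open>at_bot\<close>. Writing Q as \<Phi>(0,t)
    \<Phi>(t,0) Q bounds its norm by \<open>C\<close> times a decaying term.\<close>
  have zero: "Q = 0" if F: "F \<noteq> bot" and ev: "\<forall>\<^sub>F t in F. mnorm (evolution_operator B t 0 ** Q) \<le> K * \<sigma> t powr c"
    and lim: "((\<lambda>t. \<sigma> t powr c) \<longlongrightarrow> 0) F" for Q F c
  proof -
    have "\<forall>\<^sub>F t in F. mnorm Q \<le> C * (K * \<sigma> t powr c)"
      using ev
    proof eventually_elim
      case (elim t)
      have "evolution_operator B 0 t ** (evolution_operator B t 0 ** Q) = Q"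
        by (simp add: matrix_mul_assoc evolution_operator_cocycle[OF B] evolution_operator_refl[OF B])
      then have "mnorm Q \<le> mnorm (evolution_operator B 0 t) * mnorm (evolution_operator B t 0 ** Q)"
        using mnorm_mult by metis
      also have "\<dots> \<le> C * (K * \<sigma> t powr c)"
        by (intro mult_mono bd elim C0 mnorm_nonneg)
      finally show ?case .
    qed
    moreover have "((\<lambda>t. C * (K * \<sigma> t powr c)) \<longlongrightarrow> C * (K * 0)) F"
      by (intro tendsto_intros lim)
    ultimately have "mnorm Q \<le> C * (K * 0)"
      using F tendsto_lowerbound by blast
    then show "Q = 0" by (simp add: mnorm_le_zero_iff)
  qed
  have "P 0 = 0"
  proof (rule zero)
    show "\<forall>\<^sub>F t in at_top. mnorm (evolution_operator B t 0 ** P 0) \<le> K * \<sigma> t powr \<alpha>"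
      using eventually_ge_at_top[of 0] by eventually_elim (use f[of 0] \<sigma>0 in auto)
    show "((\<lambda>t. \<sigma> t powr \<alpha>) \<longlongrightarrow> 0) at_top"
      using \<alpha> growth_rateD(5)[OF \<sigma>] by (rule tendsto_neg_powr)
  qed simp
  moreover have "mat 1 - P 0 = 0"
  proof (rule zero)
    show "\<forall>\<^sub>F t in at_bot. mnorm (evolution_operator B t 0 ** (mat 1 - P 0)) \<le> K * \<sigma> t powr \<beta>"
      using eventually_le_at_bot[of 0] by eventually_elim (use g[of _ 0] \<sigma>0 in auto)
    show "((\<lambda>t. \<sigma> t powr \<beta>) \<longlongrightarrow> 0) at_bot"
      using growth_rateD(6)[OF \<sigma>] \<beta> growth_rateD(1)[OF \<sigma>]
      by (auto intro!: tendsto_zero_powrI[where b = \<beta>] simp: less_imp_le)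
  qed simp
  \<comment> \<open>Here N >= 1 enters: an index type is nonempty, so the identity matrix has norm 1
    and is not 0.\<close>
  ultimately have "(mat 1 :: real^'n^'n) = 0" by simp
  then show False using mnorm_mat_1 mnorm_zero by (metis zero_neq_one)
qed

theorem theorem4p6:
  fixes \<Omega> :: "(real \<Rightarrow> real^'n^'n) topology"
    and \<omega> :: "real \<Rightarrow> real^'n^'n"
    and \<mu> :: "real \<Rightarrow> real"
  assumes base: "skew_product_base \<Omega>"
    and point: "\<omega> \<in> topspace \<Omega>"
    and rate: "growth_rate \<mu>"
    and slow: "slow \<mu>"
  shows "(has_growth \<mu> (orbit_coeff \<omega>) \<longleftrightarrow>
            pinfty_notin_spectrum \<mu> \<omega> \<and> minfty_notin_spectrum \<mu> \<omega>) \<and>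
         (has_growth \<mu> (orbit_coeff \<omega>) \<longrightarrow>
            (\<forall>\<omega>' \<in> alpha_limit_set \<Omega> \<omega> \<union> omega_limit_set \<Omega> \<omega>.
               \<forall>\<sigma>. growth_rate \<sigma> \<longrightarrow> \<not> nonuniform_dichotomy \<sigma> (orbit_coeff \<omega>')))"
proof (intro conjI impI ballI allI)
  have "locally_integrable \<omega>"
    using base point by (simp add: skew_product_base_def)
  then show "has_growth \<mu> (orbit_coeff \<omega>) \<longleftrightarrow>
            pinfty_notin_spectrum \<mu> \<omega> \<and> minfty_notin_spectrum \<mu> \<omega>"
    unfolding orbit_coeff_eq by (rule has_growth_iff_infty_notin_spectrum[OF rate])
next
  fix \<omega>' \<sigma>
  assume growth: "has_growth \<mu> (orbit_coeff \<omega>)" and \<sigma>: "growth_rate \<sigma>"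
    and \<omega>': "\<omega>' \<in> alpha_limit_set \<Omega> \<omega> \<union> omega_limit_set \<Omega> \<omega>"
  obtain C where "\<And>t s. mnorm (evolution_operator \<omega>' t s) \<le> C"
    using limit_evolution_operator_bounded[OF base point rate slow growth[unfolded orbit_coeff_eq] \<omega>']
    by blast
  moreover have "locally_integrable \<omega>'"
    using base \<omega>' by (auto simp: skew_product_base_def alpha_limit_set_def omega_limit_set_def)
  ultimately show "\<not> nonuniform_dichotomy \<sigma> (orbit_coeff \<omega>')"
    unfolding orbit_coeff_eq using \<sigma> by (intro bounded_evolution_no_dichotomy)
qed

end
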